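(* Suppose Assumptions 1 and 2 (stated in the context) hold, that $f=\max_{1\le i\le p}\phi_i$ has bounded level sets, and that Algorithm GraFuS (described in the context), run with $\nu_{\mathrm{opt}}=0$, produces an infinite sequence $\{x_k\}$. Then, with probability one, the sequence $\{\nu_k\}$ converges to zero.
   Context: **Setting.** $\phi_1,\dots,\phi_p:\mathbb R^n\to\mathbb R$ are of class $C^2$, $f(x)=\max_{1\le i\le p}\phi_i(x)$, and $\mathcal I(x)=\{i:\phi_i(x)=f(x)\}$. $\mathcal D\subset\mathbb R^n$ is an open dense set of full measure on which $f$ is continuously differentiable. $\mathcal B(x,\epsilon)$ is the closed Euclidean ball, $\|\cdot\|$ the Euclidean norm, $e$ the all-ones vector. **Quadratic problem.** For a pair $(k,l)$, with sample points $x^l_{k,1},\dots,x^l_{k,m}\in\mathcal D$, put $(\tilde f_{k,l})_j=f(x^l_{k,j})+\nabla f(x^l_{k,j})^T(x_k-x^l_{k,j})$ and $G_{k,l}=[\nabla f(x^l_{k,1}),\dots,\nabla f(x^l_{k,m})]$. The primal problem QP$(k,l)$ is $$\min_{(d,z)\in\mathbb R^n\times\mathbb R} z+\tfrac12 d^TH_kd\quad\text{s.t. } \tilde f_{k,l}+G_{k,l}^Td\le ze,\ \|d\|_\infty\le\Delta_{k,l},$$ and its dual is $$\max_{\lambda\in\mathbb R^m,\,\omega\in\mathbb R^n}\lambda^T\tilde f_{k,l}-\tfrac12(G_{k,l}\lambda+\omega)^TH_k^{-1}(G_{k,l}\lambda+\omega)-\Delta_{k,l}\|\omega\|_1\quad\text{s.t.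 } e^T\lambda=1,\ \lambda\ge0.$$ (If $\Delta_{k,l}=+\infty$, the bound on $d$ is void and $\omega=0$.) **Algorithm GraFuS.** Step 0: Set $k=l=0$, $x_0\in\mathbb R^n$, $1\le\sigma_0\le2$, $m\in\mathbb N$ with $m\ge n+1$, and fixed reals $\gamma_\epsilon,\gamma_\Delta>0$, $0<\nu_0,\theta,\rho,\delta<1$, $0\le\nu_{\mathrm{opt}}<\nu_0$, $\varrho>1$; $\epsilon_{0,0}=\gamma_\epsilon\nu_0$, $\Delta_{0,0}=\gamma_\Delta\nu_0$. Step 1: Choose $x^l_{k,1},\dots,x^l_{k,m}\in\mathcal B(x_k,(\epsilon_{k,l})^{\sigma_k})$ randomly, independently and uniformly. If some sampled point is not in $\mathcal D$, STOP. Otherwise form $\tilde f_{k,l},G_{k,l}$. Step 2: Find $(d_{k,l},z_{k,l})$ and $(\lambda_{k,l},\omega_{k,l})$ solving QP$(k,l)$ and its dual, where $H_k\in\mathbb R^{n\times n}$ is symmetric positive definite. Step 3: If $\|H_k^{-1}G_{k,l}\lambda_{k,l}\|\ge\nu_k$ and $\Delta_{k,l}<+\infty$, go to Step 4. Otherwise: if $\|d_{k,l}\|_\infty<\Delta_{k,l}$, choose $\sigma_{k+1}\in[1,2]$, set $\nu_{k+1}=\min\{\max\{\|H_k^{-1}G_{k,l}\lambda_{k,l}\|,(\nu_k)^\varrho\},\delta\nu_k\}$ and go to Step 6; if $\|d_{k,l}\|_\infty=\Delta_{k,l}$, set $\Delta_{k,l+1}=+\infty$, $G_{k,l+1}=G_{k,l}$,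 $\tilde f_{k,l+1}=\tilde f_{k,l}$ (same sample points and sampling radius), $l\leftarrow l+1$ and go to Step 2. Step 4: Compute $\mathrm{Ared}_{k,l}=f(x_k)-f(x_k+d_{k,l})$ and $\mathrm{Pred}_{k,l}=\max_i(\tilde f_{k,l})_i-(z_{k,l}+\tfrac12d_{k,l}^TH_kd_{k,l})$. Step 5: If $\mathrm{Ared}_{k,l}\le\rho\,\mathrm{Pred}_{k,l}$, set $\Delta_{k,l+1}=\theta\Delta_{k,l}$, $\epsilon_{k,l+1}=\theta\epsilon_{k,l}$, $l\leftarrow l+1$ and go to Step 1. Otherwise set $\nu_{k+1}=\nu_k$, $\sigma_{k+1}=\sigma_k$. Step 6: If $\nu_{k+1}<\nu_{\mathrm{opt}}$, terminate. Otherwise set $x_{k+1}=x_k+d_{k,l}$, $\epsilon_{k+1,0}=\gamma_\epsilon\nu_{k+1}$, $\Delta_{k+1,0}=\gamma_\Delta\nu_{k+1}$, $k\leftarrow k+1$, $l\leftarrow0$ and go to Step 1. Probability refers to the random sampling in Step 1. **Assumption 1.** Each $H_k$ is symmetric positive definite and there are $\underline\varsigma,\overline\varsigma>0$ with $\underline\varsigma\|d\|^2\le d^TH_kd\le\overline\varsigma\|d\|^2$ for all $d\in\mathbb R^n$ and all $k$. **Assumption 2.** For all $x$ with $|\mathcal I(x)|\ge2$, the gradients $\{\nabla\phi_i(x)\}_{i\in\mathcal I(x)}$ are affinely independent: $\sum_{i\in\mathcal I(x)}\alpha_i\nabla\phi_i(x)=0$ and $\sum_{i\in\mathcal I(x)}\alpha_i=0$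 imply all $\alpha_i=0$. *)

theory Defs
  imports "HOL-Probability.Probability"
begin

definition max_fun :: "(nat \<Rightarrow> real^'n \<Rightarrow> real) \<Rightarrow> nat \<Rightarrow> real^'n \<Rightarrow> real" where
  "max_fun \<phi> p x = Max ((\<lambda>i. \<phi> i x) ` {1..p})"

definition active :: "(nat \<Rightarrow> real^'n \<Rightarrow> real) \<Rightarrow> nat \<Rightarrow> real^'n \<Rightarrow> nat set" where
  "active \<phi> p x = {i \<in> {1..p}. \<phi> i x = max_fun \<phi> p x}"

definition gradient :: "(real^'n \<Rightarrow> real) \<Rightarrow> real^'n \<Rightarrow> real^'n" where
  "gradient g x = (THE D. GDERIV g x :> D)"

definition C2 :: "(real^'n \<Rightarrow> real) \<Rightarrow> bool" where
  "C2 g \<longleftrightarrow> (\<exists>g' (g'' :: real^'n \<Rightarrow> real^'n^'n).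
     (\<forall>x. GDERIV g x :> g' x) \<and>
     (\<forall>x. (g' has_derivative (\<lambda>v. g'' x *v v)) (at x)) \<and>
     continuous_on UNIV g'')"

definition smooth_domain :: "(real^'n \<Rightarrow> real) \<Rightarrow> (real^'n) set \<Rightarrow> bool" where
  "smooth_domain f D \<longleftrightarrow> open D \<and> closure D = UNIV \<and> negligible (- D) \<and>
     (\<forall>x\<in>D. f differentiable (at x)) \<and> continuous_on D (gradient f)"

definition bounded_level_sets :: "(real^'n \<Rightarrow> real) \<Rightarrow> bool" where
  "bounded_level_sets f \<longleftrightarrow> (\<forall>a. bounded {x. f x \<le> a})"

text \<open>
  Affine independence of the \<^emph>\<open>family\<close> of active gradients. The library predicate on sets of
  vectors is not used, because it would identify active indices with equal gradients.
\<close>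

definition active_gradients_affinely_independent ::
  "(nat \<Rightarrow> real^'n \<Rightarrow> real) \<Rightarrow> nat \<Rightarrow> bool" where
  "active_gradients_affinely_independent \<phi> p \<longleftrightarrow>
     (\<forall>x. card (active \<phi> p x) \<ge> 2 \<longrightarrow>
       (\<forall>\<alpha> :: nat \<Rightarrow> real.
          (\<Sum>i\<in>active \<phi> p x. \<alpha> i *\<^sub>R gradient (\<phi> i) x) = 0 \<and>
          (\<Sum>i\<in>active \<phi> p x. \<alpha> i) = 0 \<longrightarrow>
          (\<forall>i\<in>active \<phi> p x. \<alpha> i = 0)))"

definition sym_pos_def :: "real^'n^'n \<Rightarrow> bool" where
  "sym_pos_def H \<longleftrightarrow> transpose H = H \<and> (\<forall>v. v \<noteq> 0 \<longrightarrow> v \<bullet> (H *v v) > 0)"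

definition ftilde :: "(real^'n \<Rightarrow> real) \<Rightarrow> real^'n \<Rightarrow> ('m::finite \<Rightarrow> real^'n) \<Rightarrow> real^'m" where
  "ftilde f x X = (\<chi> j. f (X j) + gradient f (X j) \<bullet> (x - X j))"

definition Gmat :: "(real^'n \<Rightarrow> real) \<Rightarrow> ('m::finite \<Rightarrow> real^'n) \<Rightarrow> real^'m^'n" where
  "Gmat f X = (\<chi> i j. gradient f (X j) $ i)"

definition QP_objective :: "real^'n^'n \<Rightarrow> (real^'n) \<times> real \<Rightarrow> real" where
  "QP_objective H = (\<lambda>(d, z). z + (d \<bullet> (H *v d)) / 2)"

definition QP_feasible :: "real^'m \<Rightarrow> real^'m^'n \<Rightarrow> ereal \<Rightarrow> (real^'n) \<times> real \<Rightarrow> bool" where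
  "QP_feasible ft G \<Delta> = (\<lambda>(d, z).
     (\<forall>j. (ft + transpose G *v d) $ j \<le> z) \<and> ereal (infnorm d) \<le> \<Delta>)"

text \<open>
  For an infinite trust radius the dual has no variable \<open>\<omega>\<close>: it is forced to be zero, so that the
  junk value of \<open>real_of_ereal \<infinity>\<close> is irrelevant.
\<close>

definition dual_objective ::
  "real^'m \<Rightarrow> real^'m^'n \<Rightarrow> real^'n^'n \<Rightarrow> ereal \<Rightarrow> (real^'m) \<times> (real^'n) \<Rightarrow> real" where
  "dual_objective ft G H \<Delta> = (\<lambda>(l, w).
     l \<bullet> ft - ((G *v l + w) \<bullet> (matrix_inv H *v (G *v l + w))) / 2
       - real_of_ereal \<Delta> * (\<Sum>i\<in>UNIV. \<bar>w $ i\<bar>))"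

definition dual_feasible :: "ereal \<Rightarrow> (real^'m) \<times> (real^'n) \<Rightarrow> bool" where
  "dual_feasible \<Delta> = (\<lambda>(l, w).
     (\<Sum>j\<in>UNIV. l $ j) = 1 \<and> (\<forall>j. l $ j \<ge> 0) \<and> (\<Delta> = \<infinity> \<longrightarrow> w = 0))"

record ('n::finite) grafus_params =
  p_x0 :: "real^'n"
  p_sigma0 :: real
  p_nu0 :: real
  p_nu_opt :: real
  p_gamma_eps :: real
  p_gamma_Delta :: real
  p_theta :: real
  p_rho :: real
  p_delta :: real
  p_varrho :: real

definition valid_params :: "('n::finite) grafus_params \<Rightarrow> bool" where
  "valid_params P \<longleftrightarrow>
     1 \<le> p_sigma0 P \<and> p_sigma0 P \<le> 2 \<and>
     0 < p_gamma_eps P \<and> 0 < p_gamma_Delta P \<and>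
     0 < p_nu0 P \<and> p_nu0 P < 1 \<and> 0 < p_theta P \<and> p_theta P < 1 \<and>
     0 < p_rho P \<and> p_rho P < 1 \<and> 0 < p_delta P \<and> p_delta P < 1 \<and>
     0 \<le> p_nu_opt P \<and> p_nu_opt P < p_nu0 P \<and> 1 < p_varrho P"

text \<open>
  An execution is a sequence of passes, each of which treats one pair \<open>(k, l)\<close>. A pass is entered
  either at Step 1 (\<open>Sampling\<close>: new points are drawn) or at Step 2 (\<open>Resolving\<close>: the subproblem is
  solved again with the old points and an infinite trust radius); \<open>Halted\<close> is entered by the STOP in
  Step 1 and by the termination in Step 6. A state holds what is known when a pass is entered,
  pass data hold what is sampled, chosen and computed during the pass.
\<close>

datatype phase = Sampling | Resolving | Halted

record ('n::finite) grafus_state =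
  s_phase :: phase
  s_k :: nat
  s_l :: nat
  s_x :: "real^'n"
  s_sigma :: real
  s_nu :: real
  s_eps :: real
  s_Delta :: ereal

record ('n::finite, 'm::finite) grafus_pass =
  y_X :: "'m \<Rightarrow> real^'n"
  y_H :: "real^'n^'n"
  y_d :: "real^'n"
  y_z :: real
  y_lam :: "real^'m"
  y_om :: "real^'n"

definition initial_state :: "('n::finite) grafus_params \<Rightarrow> 'n grafus_state" where
  "initial_state P = \<lparr>s_phase = Sampling, s_k = 0, s_l = 0, s_x = p_x0 P, s_sigma = p_sigma0 P,
     s_nu = p_nu0 P, s_eps = p_gamma_eps P * p_nu0 P, s_Delta = ereal (p_gamma_Delta P * p_nu0 P)\<rparr>"

definition sampling_ball :: "('n::finite) grafus_state \<Rightarrow> (real^'n) set" where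
  "sampling_ball s = cball (s_x s) (s_eps s powr s_sigma s)"

definition step1 :: "('n::finite) grafus_state \<Rightarrow> ('n, 'm::finite) grafus_pass \<Rightarrow> bool" where
  "step1 s y \<longleftrightarrow> (\<forall>j. y_X y j \<in> sampling_ball s)"

definition step2 ::
  "(real^'n \<Rightarrow> real) \<Rightarrow> ('n::finite) grafus_state \<Rightarrow> ('n, 'm::finite) grafus_pass \<Rightarrow> bool" where
  "step2 f s y \<longleftrightarrow>
     (let ft = ftilde f (s_x s) (y_X y); G = Gmat f (y_X y); \<Delta> = s_Delta s in
      sym_pos_def (y_H y) \<and>
      is_arg_min (QP_objective (y_H y)) (QP_feasible ft G \<Delta>) (y_d y, y_z y) \<and>
      is_arg_max (dual_objective ft G (y_H y) \<Delta>) (dual_feasible \<Delta>) (y_lam y, y_om y))"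

definition opt_measure ::
  "(real^'n \<Rightarrow> real) \<Rightarrow> ('n::finite, 'm::finite) grafus_pass \<Rightarrow> real" where
  "opt_measure f y = norm (matrix_inv (y_H y) *v (Gmat f (y_X y) *v y_lam y))"

definition Ared ::
  "(real^'n \<Rightarrow> real) \<Rightarrow> ('n::finite) grafus_state \<Rightarrow> ('n, 'm::finite) grafus_pass \<Rightarrow> real" where
  "Ared f s y = f (s_x s) - f (s_x s + y_d y)"

definition Pred ::
  "(real^'n \<Rightarrow> real) \<Rightarrow> ('n::finite) grafus_state \<Rightarrow> ('n, 'm::finite) grafus_pass \<Rightarrow> real" where
  "Pred f s y = Max (range (\<lambda>j. ftilde f (s_x s) (y_X y) $ j))
     - QP_objective (y_H y) (y_d y, y_z y)"

definition step6 ::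
  "('n::finite) grafus_params \<Rightarrow> 'n grafus_state \<Rightarrow> ('n, 'm::finite) grafus_pass \<Rightarrow>
   real \<Rightarrow> real \<Rightarrow> 'n grafus_state" where
  "step6 P s y nu' sigma' =
     (if nu' < p_nu_opt P then s\<lparr>s_phase := Halted\<rparr>
      else \<lparr>s_phase = Sampling, s_k = Suc (s_k s), s_l = 0, s_x = s_x s + y_d y,
             s_sigma = sigma', s_nu = nu', s_eps = p_gamma_eps P * nu',
             s_Delta = ereal (p_gamma_Delta P * nu')\<rparr>)"

definition steps_3_to_6 ::
  "(real^'n \<Rightarrow> real) \<Rightarrow> 'n grafus_params \<Rightarrow> ('n::finite) grafus_state \<Rightarrow>
   ('n, 'm::finite) grafus_pass \<Rightarrow> 'n grafus_state \<Rightarrow> bool" where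
  "steps_3_to_6 f P s y s' \<longleftrightarrow>
     (if opt_measure f y \<ge> s_nu s \<and> s_Delta s < \<infinity> then
        (if Ared f s y \<le> p_rho P * Pred f s y then
           s' = s\<lparr>s_phase := Sampling, s_l := Suc (s_l s), s_eps := p_theta P * s_eps s,
                  s_Delta := ereal (p_theta P) * s_Delta s\<rparr>
         else s' = step6 P s y (s_nu s) (s_sigma s))
      else if ereal (infnorm (y_d y)) < s_Delta s then
        (\<exists>sigma'\<in>{1..2}. s' = step6 P s y
           (min (max (opt_measure f y) (s_nu s powr p_varrho P)) (p_delta P * s_nu s)) sigma')
      else s' = s\<lparr>s_phase := Resolving, s_l := Suc (s_l s), s_Delta := \<infinity>\<rparr>)"

definition reaches_step2 ::
  "(real^'n) set \<Rightarrow> ('n::finite) grafus_state \<Rightarrow> ('n, 'm::finite) grafus_pass \<Rightarrow> bool" where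
  "reaches_step2 D s y \<longleftrightarrow> s_phase s \<noteq> Halted \<and> (\<forall>j. y_X y j \<in> D)"

definition transition ::
  "(real^'n \<Rightarrow> real) \<Rightarrow> (real^'n) set \<Rightarrow> ('n::finite) grafus_params \<Rightarrow>
   'n grafus_state \<Rightarrow> ('n, 'm::finite) grafus_pass \<Rightarrow> 'n grafus_state \<Rightarrow> bool" where
  "transition f D P s y s' \<longleftrightarrow>
     (s_phase s = Sampling \<longrightarrow> step1 s y) \<and>
     (if reaches_step2 D s y then step2 f s y \<and> steps_3_to_6 f P s y s'
      else s' = s\<lparr>s_phase := Halted\<rparr>)"

text \<open>
  The last two conditions link successive passes: \<open>H\<^sub>k\<close> does not depend on \<open>l\<close>, and a pass
  entered at Step 2 keeps the sample points.
\<close>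

definition grafus_run ::
  "(real^'n \<Rightarrow> real) \<Rightarrow> (real^'n) set \<Rightarrow> ('n::finite) grafus_params \<Rightarrow>
   (nat \<Rightarrow> 'n grafus_state) \<Rightarrow> (nat \<Rightarrow> ('n, 'm::finite) grafus_pass) \<Rightarrow> bool" where
  "grafus_run f D P S Y \<longleftrightarrow>
     S 0 = initial_state P \<and>
     (\<forall>t. transition f D P (S t) (Y t) (S (Suc t))) \<and>
     (\<forall>t. reaches_step2 D (S (Suc t)) (Y (Suc t)) \<and> s_k (S (Suc t)) = s_k (S t) \<longrightarrow>
          y_H (Y (Suc t)) = y_H (Y t)) \<and>
     (\<forall>t. s_phase (S (Suc t)) = Resolving \<longrightarrow> y_X (Y (Suc t)) = y_X (Y t))"

definition infinite_iterates :: "(nat \<Rightarrow> ('n::finite) grafus_state) \<Rightarrow> bool" where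
  "infinite_iterates S \<longleftrightarrow> (\<forall>k. \<exists>t. s_k (S t) = k)"

text \<open>\<open>\<nu>\<^sub>k\<close>, read off at the first pass belonging to \<open>k\<close> (it is the same in all of them).\<close>

definition nu_seq :: "(nat \<Rightarrow> ('n::finite) grafus_state) \<Rightarrow> nat \<Rightarrow> real" where
  "nu_seq S k = s_nu (S (LEAST t. s_k (S t) = k))"

definition uniformly_elliptic ::
  "(real^'n) set \<Rightarrow> (nat \<Rightarrow> ('n::finite) grafus_state) \<Rightarrow>
   (nat \<Rightarrow> ('n, 'm::finite) grafus_pass) \<Rightarrow> bool" where
  "uniformly_elliptic D S Y \<longleftrightarrow> (\<exists>c>0. \<exists>C>0. \<forall>t. reaches_step2 D (S t) (Y t) \<longrightarrow>
     sym_pos_def (y_H (Y t)) \<and>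
     (\<forall>d. c * (norm d)\<^sup>2 \<le> d \<bullet> (y_H (Y t) *v d) \<and> d \<bullet> (y_H (Y t) *v d) \<le> C * (norm d)\<^sup>2))"

text \<open>
  \<open>F t\<close> is the history before the sampling of pass \<open>t\<close>: it contains the state entering pass \<open>t\<close> and
  the earlier sample points. Given \<open>F t\<close>, the points sampled in pass \<open>t\<close> are independent and
  uniformly distributed on the sampling ball, which is itself random through the history. How
  \<open>H\<^sub>k\<close>, \<open>\<sigma>\<^sub>k\<close> and the solutions of the subproblems are selected is left open.
\<close>

definition random_sampling ::
  "'a measure \<Rightarrow> (nat \<Rightarrow> 'a measure) \<Rightarrow> (nat \<Rightarrow> 'a \<Rightarrow> ('n::finite) grafus_state) \<Rightarrow>
   (nat \<Rightarrow> 'a \<Rightarrow> ('n, 'm::finite) grafus_pass) \<Rightarrow> bool" where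
  "random_sampling M F S Y \<longleftrightarrow>
     filtration (space M) F \<and> (\<forall>t. subalgebra M (F t)) \<and>
     (\<forall>t. (\<lambda>\<omega>. s_phase (S t \<omega>)) \<in> measurable (F t) (count_space UNIV) \<and>
          (\<lambda>\<omega>. s_k (S t \<omega>)) \<in> measurable (F t) (count_space UNIV) \<and>
          (\<lambda>\<omega>. s_l (S t \<omega>)) \<in> measurable (F t) (count_space UNIV) \<and>
          (\<lambda>\<omega>. s_x (S t \<omega>)) \<in> borel_measurable (F t) \<and>
          (\<lambda>\<omega>. s_sigma (S t \<omega>)) \<in> borel_measurable (F t) \<and>
          (\<lambda>\<omega>. s_nu (S t \<omega>)) \<in> borel_measurable (F t) \<and>
          (\<lambda>\<omega>. s_eps (S t \<omega>)) \<in> borel_measurable (F t) \<and>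
          (\<lambda>\<omega>. s_Delta (S t \<omega>)) \<in> borel_measurable (F t)) \<and>
     (\<forall>t j. (\<lambda>\<omega>. y_X (Y t \<omega>) j) \<in> borel_measurable (F (Suc t))) \<and>
     (\<forall>t (A :: 'm \<Rightarrow> (real^'n) set). (\<forall>j. A j \<in> sets borel) \<longrightarrow>
        (AE \<omega> in M. s_phase (S t \<omega>) = Sampling \<longrightarrow>
           real_cond_exp M (F t)
             (indicat_real {\<omega>' \<in> space M. \<forall>j. y_X (Y t \<omega>') j \<in> A j}) \<omega>
           = (\<Prod>j\<in>UNIV. measure (uniform_measure lborel (sampling_ball (S t \<omega>))) (A j))))"

end

theory Submission
  imports Defs
begin

text \<open>
  The proof is by contradiction. Every change of \<open>\<nu>\<close> multiplies it by at most \<open>\<delta> < 1\<close>, so if \<open>\<nu>\<close> does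
  not tend to zero, then it is constant from some pass on. In these late passes the optimality
  measure is at least \<open>\<nu>\<close>, the trust radius is finite, and a pass either rejects its step, going to
  the next level \<open>l\<close> (\<open>\<epsilon>\<close> and \<open>\<Delta>\<close> shrink by \<open>\<theta>\<close>), or accepts it, starting again at level \<open>0\<close>. Two
  facts about such passes contradict each other.

  A fixed level accepts only finitely often. A maximiser of the dual problem determines a feasible
  primal point of no larger value, which bounds the predicted reduction from below by
  \<open>min (c \<nu>\<^sup>2 / 8) (c \<nu> \<Delta> / 2)\<close> (\<open>Pred_lower_bound\<close>). An acceptance at level \<open>l\<close> therefore decreases
  \<open>f\<close> by a fixed amount, and \<open>f\<close> is bounded below on its compact level sets. The iterates stay in such
  a level set and have a limit point \<open>xb\<close>. As infinitely many steps are accepted, but at ever higher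
  levels, each level is passed through infinitely often near \<open>xb\<close>, and the step is rejected there
  from some pass on (\<open>stagnating_run_rejects_near_limit_point\<close>).

  A suitable level accepts infinitely often. Affine independence of the active gradients at \<open>xb\<close>
  yields, arbitrarily near \<open>xb\<close> and for each active \<open>i\<close>, a nonempty open set on which \<open>f = \<phi>\<^sub>i\<close>; it also
  bounds the number of active pieces by \<open>n + 1\<close>, so that \<open>m \<ge> n + 1\<close> sample points can represent
  them all. The piecewise linear model of such a sample agrees with \<open>f\<close> up to \<open>\<eta> \<Delta>\<close> with \<open>\<eta>\<close> as small
  as desired, whereas the predicted reduction is at least \<open>\<kappa> \<Delta>\<close>; hence the step is accepted when
  \<open>\<Delta>\<close> is small (\<open>accepting_samples_exist\<close>). Given the past, these samples occur with a probability
  bounded away from zero, and thus occur infinitely often if there are infinitely many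
  opportunities (\<open>conditional_Borel_Cantelli\<close>).

  The limit point, the ellipticity constant and the limit of \<open>\<nu>\<close> depend on the outcome, while
  exceptional null sets may be united only countably often. Hence the constants are bounded below
  by \<open>1 / (N + 1)\<close>, and the limit point is only required to lie in one of countably many balls, each
  with an acceptance level and sample sets of its own.
\<close>

section \<open>Smooth pieces and the active maximum\<close>

lemma gradient_eqI:
  assumes "GDERIV g x :> D"
  shows "gradient g x = D"
proof -
  have "E = D" if "GDERIV g x :> E" for E
  proof -
    have "(\<lambda>h. inner h E) = (\<lambda>h. inner h D)"
      using that assms unfolding gderiv_def by (rule has_derivative_unique)
    then have "\<forall>h. h \<bullet> E = h \<bullet> D" by meson
    then show ?thesis by (simp only: vector_eq_ldot)
  qed
  then show ?thesis
    unfolding gradient_def using assms by blast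
qed

lemma C2_GDERIV:
  assumes "C2 g"
  shows "GDERIV g x :> gradient g x"
  using assms unfolding C2_def by (metis gradient_eqI)

lemma C2_continuous_gradient:
  assumes "C2 g"
  shows "isCont (gradient g) x"
proof -
  obtain g' g'' where g': "\<And>x. GDERIV g x :> g' x"
    and g'': "\<And>x. (g' has_derivative (\<lambda>v. (g'' x :: real^'a^'a) *v v)) (at x)"
    using assms unfolding C2_def by blast
  have "gradient g = g'"
    using g' gradient_eqI by blast
  then show ?thesis
    using g''[of x] has_derivative_continuous by metis
qed

lemma C2_isCont:
  assumes "C2 g"
  shows "isCont g x"
  using C2_GDERIV[OF assms, of x] unfolding gderiv_def
  by (rule has_derivative_continuous)

text \<open>
  The base point \<open>u\<close> may vary together with \<open>v\<close>, which plain differentiability at \<open>a\<close> does not allow: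
  later both the sample point and the trial point move. On a ball where the gradient oscillates by at
  most \<open>\<eta>\<close>, the mean value inequality for \<open>w \<mapsto> g w - w \<bullet> \<nabla>g u\<close> gives the bound.
\<close>

lemma C2_strict_differentiability:
  assumes "C2 g" and "\<eta> > 0"
  obtains R where "R > 0"
    and "\<And>u v. u \<in> ball a R \<Longrightarrow> v \<in> ball a R \<Longrightarrow>
           \<bar>g v - (g u + gradient g u \<bullet> (v - u))\<bar> \<le> \<eta> * norm (v - u)"
proof -
  obtain R where R: "R > 0"
    and near: "\<And>u. dist u a < R \<Longrightarrow> dist (gradient g u) (gradient g a) < \<eta> / 2"
    using C2_continuous_gradient[OF assms(1), of a] assms(2)
    unfolding continuous_at_eps_delta by (meson half_gt_zero)
  have "\<bar>g v - (g u + gradient g u \<bullet> (v - u))\<bar> \<le> \<eta> * norm (v - u)"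
    if u: "u \<in> ball a R" and v: "v \<in> ball a R" for u v
  proof -
    define h where "h w = g w - w \<bullet> gradient g u" for w
    have der: "(h has_derivative (\<lambda>k. k \<bullet> (gradient g w - gradient g u))) (at w within ball a R)"
      for w
      unfolding h_def inner_diff_right
      using C2_GDERIV[OF assms(1), of w] unfolding gderiv_def
      by (intro derivative_intros) (auto intro: has_derivative_at_withinI)
    have "norm (h v - h u) \<le> \<eta> * norm (v - u)"
    proof (rule differentiable_bound[OF _ der _ v u])
      fix w assume w: "w \<in> ball a R"
      have "norm (gradient g w - gradient g u) \<le> \<eta>"
        using near[of w] near[of u] w u
        by (smt (verit) dist_commute dist_norm dist_triangle field_sum_of_halves mem_ball)
      then show "onorm (\<lambda>k. k \<bullet> (gradient g w - gradient g u)) \<le> \<eta>"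
        using assms(2)
        by (intro onorm_le) (metis Cauchy_Schwarz_ineq2 mult.commute mult_right_mono
            norm_ge_zero order_trans real_norm_def)
    qed simp
    then show ?thesis
      unfolding h_def by (simp add: algebra_simps inner_commute)
  qed
  with R that show ?thesis by blast
qed

lemma max_fun_ge: "i \<in> {1..p} \<Longrightarrow> \<phi> i x \<le> max_fun \<phi> p x"
  unfolding max_fun_def by (rule Max_ge) auto

lemma max_fun_attained:
  assumes "p \<ge> 1" obtains i where "i \<in> {1..p}" "max_fun \<phi> p x = \<phi> i x"
proof -
  have "Max ((\<lambda>i. \<phi> i x) ` {1..p}) \<in> (\<lambda>i. \<phi> i x) ` {1..p}"
    using assms by (intro Max_in) auto
  then show ?thesis using that unfolding max_fun_def by auto
qed

lemma max_fun_eqI: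
  assumes "i \<in> {1..p}" "\<And>i'. i' \<in> {1..p} - {i} \<Longrightarrow> \<phi> i' x \<le> \<phi> i x"
  shows "max_fun \<phi> p x = \<phi> i x"
  unfolding max_fun_def using assms by (intro Max_eqI)
    (auto, metis Diff_iff atLeastAtMost_iff order_refl singletonD)

lemma active_nonempty: "p \<ge> 1 \<Longrightarrow> active \<phi> p x \<noteq> {}"
  by (metis (mono_tags, lifting) active_def empty_Collect_eq max_fun_attained)

lemma continuous_max_fun:
  assumes "p \<ge> 1" and "\<And>i. i \<in> {1..p} \<Longrightarrow> C2 (\<phi> i)"
  shows "continuous_on UNIV (max_fun \<phi> p)"
proof -
  have "continuous_on UNIV (\<lambda>x. Max ((\<lambda>i. \<phi> i x) ` A))"
    if "finite A" "A \<noteq> {}" "A \<subseteq> {1..p}" for A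
    using that
  proof (induction rule: finite_ne_induct)
    case (singleton i)
    then show ?case using C2_isCont[OF assms(2)[of i]]
      by (simp add: continuous_at_imp_continuous_on)
  next
    case (insert i A)
    have "Max ((\<lambda>i. \<phi> i x) ` insert i A) = max (\<phi> i x) (Max ((\<lambda>i. \<phi> i x) ` A))" for x
      using insert by simp
    moreover have "continuous_on UNIV (\<phi> i)"
      using C2_isCont[OF assms(2)[of i]] insert by (simp add: continuous_at_imp_continuous_on)
    ultimately show ?case using insert by (auto intro: continuous_intros)
  qed
  from this[of "{1..p}"] show ?thesis
    using assms(1) unfolding max_fun_def[abs_def] by auto
qed

text \<open>
  By continuity, a piece strictly below the maximum at \<open>a\<close> stays strictly below it near \<open>a\<close>.
\<close>

lemma only_active_pieces_near:
  assumes p: "p \<ge> 1" and C2: "\<And>i. i \<in> {1..p} \<Longrightarrow> C2 (\<phi> i)"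
  obtains R where "R > 0"
    and "\<And>y. y \<in> ball a R \<Longrightarrow> \<exists>i\<in>active \<phi> p a. max_fun \<phi> p y = \<phi> i y"
proof -
  let ?f = "max_fun \<phi> p"
  have "\<forall>\<^sub>F y in nhds a. \<phi> i y < ?f y" if "i \<in> {1..p} - active \<phi> p a" for i
  proof -
    have "\<phi> i a < ?f a"
      using that max_fun_ge[of i p \<phi> a] unfolding active_def by fastforce
    moreover have "isCont ?f a"
      using continuous_max_fun[OF assms] by (simp add: continuous_on_eq_continuous_at)
    moreover have "isCont (\<phi> i) a" using that C2 C2_isCont by blast
    ultimately have "\<forall>\<^sub>F y in nhds a. 0 < ?f y - \<phi> i y"
      using order_tendstoD(1)[of "\<lambda>y. ?f y - \<phi> i y" "?f a - \<phi> i a" "nhds a" 0]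
      by (auto simp: isCont_def tendsto_at_iff_tendsto_nhds intro!: tendsto_diff)
    then show ?thesis by simp
  qed
  then have "\<forall>\<^sub>F y in nhds a. \<forall>i\<in>{1..p} - active \<phi> p a. \<phi> i y < ?f y"
    by (intro eventually_ball_finite) auto
  then obtain R where "R > 0"
    and R: "\<And>y. dist y a < R \<Longrightarrow> \<forall>i\<in>{1..p} - active \<phi> p a. \<phi> i y < ?f y"
    unfolding eventually_nhds_metric by blast
  have "\<exists>i\<in>active \<phi> p a. ?f y = \<phi> i y" if "y \<in> ball a R" for y
  proof -
    obtain i where "i \<in> {1..p}" "?f y = \<phi> i y" using max_fun_attained[OF p] by blast
    with R[of y] that show ?thesis
      by (metis Diff_iff dist_commute less_irrefl mem_ball)
  qed
  with \<open>R > 0\<close> that show ?thesis by blast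
qed

text \<open>
  A linear relation with coefficients \<open>\<beta> k\<close> between the differences is an affine relation between
  the active gradients, with coefficients \<open>- \<beta> k\<close> and, at \<open>i\<close>, the sum of all \<open>\<beta> k\<close>. Injectivity is
  a separate claim because independence of an image set does not exclude repetitions in the family.
\<close>

lemma active_gradient_differences_independent:
  assumes aff: "active_gradients_affinely_independent \<phi> p" and i: "i \<in> active \<phi> p a"
  defines "v \<equiv> \<lambda>k. gradient (\<phi> i) a - gradient (\<phi> k) a"
  shows "inj_on v (active \<phi> p a - {i})" and "independent (v ` (active \<phi> p a - {i}))"
proof -
  let ?I = "active \<phi> p a"
  have fin: "finite ?I" unfolding active_def by auto
  have zero: "\<beta> k = 0"
    if k: "k \<in> ?I - {i}" and sum: "(\<Sum>k\<in>?I - {i}. \<beta> k *\<^sub>R v k) = 0" for \<beta> :: "nat \<Rightarrow> real" and k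
  proof -
    define \<alpha> where "\<alpha> j = (if j = i then \<Sum>k\<in>?I - {i}. \<beta> k else - \<beta> j)" for j
    have "card {i, k} \<le> card ?I"
      using k i fin by (intro card_mono) auto
    then have two: "card ?I \<ge> 2" using k by auto
    have s1: "(\<Sum>j\<in>?I. \<alpha> j) = 0"
      using i fin by (subst sum.remove[of _ i]) (auto simp: \<alpha>_def sum_negf)
    have "(\<Sum>j\<in>?I. \<alpha> j *\<^sub>R gradient (\<phi> j) a)
        = (\<Sum>k\<in>?I - {i}. \<beta> k) *\<^sub>R gradient (\<phi> i) a - (\<Sum>k\<in>?I - {i}. \<beta> k *\<^sub>R gradient (\<phi> k) a)"
      using i fin by (subst sum.remove[of _ i]) (auto simp: \<alpha>_def sum_negf)
    also have "\<dots> = (\<Sum>k\<in>?I - {i}. \<beta> k *\<^sub>R v k)"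
      unfolding v_def by (simp add: scaleR_diff_right sum_subtractf scaleR_left.sum)
    finally have "\<alpha> k = 0"
      using aff two s1 sum k unfolding active_gradients_affinely_independent_def
      by (metis (no_types, lifting) DiffD1)
    with k show ?thesis by (auto simp: \<alpha>_def)
  qed
  show inj: "inj_on v (?I - {i})"
  proof (rule inj_onI, rule ccontr)
    fix j k assume jk: "j \<in> ?I - {i}" "k \<in> ?I - {i}" "v j = v k" "j \<noteq> k"
    define \<beta> where "\<beta> m = (if m = j then 1 else if m = k then -1 else 0 :: real)" for m
    have "(\<Sum>m\<in>?I - {i}. \<beta> m *\<^sub>R v m) = (\<Sum>m\<in>{j, k}. \<beta> m *\<^sub>R v m)"
      using jk fin by (intro sum.mono_neutral_right) (auto simp: \<beta>_def)
    also have "\<dots> = 0" using jk by (auto simp: \<beta>_def)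
    finally have "\<beta> j = 0" using zero[of j \<beta>] jk by blast
    then show False by (simp add: \<beta>_def)
  qed
  show "independent (v ` (?I - {i}))"
  proof (rule independent_if_scalars_zero)
    show "finite (v ` (?I - {i}))" using fin by auto
    fix u w assume sum: "(\<Sum>x\<in>v ` (?I - {i}). u x *\<^sub>R x) = 0" and w: "w \<in> v ` (?I - {i})"
    have "(\<Sum>k\<in>?I - {i}. u (v k) *\<^sub>R v k) = 0"
      using sum by (subst (asm) sum.reindex[OF inj]) simp
    with w zero[of _ "\<lambda>k. u (v k)"] show "u w = 0" by auto
  qed
qed

lemma card_active_le:
  fixes \<phi> :: "nat \<Rightarrow> real^'n \<Rightarrow> real"
  assumes "active_gradients_affinely_independent \<phi> p"
  shows "card (active \<phi> p a) \<le> CARD('n) + 1"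
proof (cases "active \<phi> p a = {}")
  case False
  then obtain i where i: "i \<in> active \<phi> p a" by blast
  let ?v = "\<lambda>k. gradient (\<phi> i) a - gradient (\<phi> k) a"
  have "card (active \<phi> p a - {i}) = card (?v ` (active \<phi> p a - {i}))"
    by (rule card_image[symmetric], rule active_gradient_differences_independent(1)[OF assms i])
  also have "\<dots> \<le> CARD('n)"
    using independent_bound[OF active_gradient_differences_independent(2)[OF assms i]] by simp
  finally show ?thesis using i by (simp add: card_Diff_singleton)
qed simp

text \<open>
  On linearly independent vectors a linear functional can be prescribed; the value 1 on all gradient
  differences makes \<open>\<phi> i\<close> grow faster along \<open>d\<close> than any other active piece.
\<close>

lemma active_ascent_direction:
  fixes \<phi> :: "nat \<Rightarrow> real^'n \<Rightarrow> real"
  assumes aff: "active_gradients_affinely_independent \<phi> p" and i: "i \<in> active \<phi> p a"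
  obtains d where
    "\<And>k. k \<in> active \<phi> p a - {i} \<Longrightarrow> (gradient (\<phi> i) a - gradient (\<phi> k) a) \<bullet> d = 1"
proof -
  let ?B = "(\<lambda>k. gradient (\<phi> i) a - gradient (\<phi> k) a) ` (active \<phi> p a - {i})"
  obtain g :: "real^'n \<Rightarrow> real" where g: "linear g" "\<forall>x\<in>?B. g x = 1"
    using linear_independent_extend[OF active_gradient_differences_independent(2)[OF aff i], of "\<lambda>_. 1"]
    by blast
  have "g x = x \<bullet> adjoint g 1" for x
    using adjoint_works[OF g(1), of x 1] by (simp add: inner_commute)
  with g(2) that show ?thesis by auto
qed

text \<open>
  Points \<open>a + t d\<close> with small \<open>t > 0\<close> and \<open>d\<close> an ascent direction of \<open>\<phi> i\<close> relative to the other
  active pieces lie in the open set where \<open>\<phi> i\<close> is strictly largest.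
\<close>

lemma piece_dominates_somewhere_near:
  fixes \<phi> :: "nat \<Rightarrow> real^'n \<Rightarrow> real"
  assumes C2: "\<And>i. i \<in> {1..p} \<Longrightarrow> C2 (\<phi> i)"
    and aff: "active_gradients_affinely_independent \<phi> p"
    and i: "i \<in> active \<phi> p a" and r: "r > 0"
  shows "\<exists>A. open A \<and> A \<noteq> {} \<and> A \<subseteq> ball a r \<and> (\<forall>u\<in>A. max_fun \<phi> p u = \<phi> i u)"
proof -
  define A where "A = ball a r \<inter> (\<Inter>k\<in>{1..p} - {i}. {u. \<phi> k u < \<phi> i u})"
  have ip: "i \<in> {1..p}" using i unfolding active_def by simp
  have "open {u. \<phi> k u < \<phi> i u}" if "k \<in> {1..p} - {i}" for k
    using that ip C2 C2_isCont
    by (intro open_Collect_less continuous_at_imp_continuous_on) auto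
  then have "open A" unfolding A_def by (intro open_Int open_INT) auto
  moreover have "A \<noteq> {}"
  proof -
    obtain d where d: "\<And>k. k \<in> active \<phi> p a - {i} \<Longrightarrow>
        (gradient (\<phi> i) a - gradient (\<phi> k) a) \<bullet> d = 1"
      using active_ascent_direction[OF aff i] by blast
    have path: "((\<lambda>t. a + t *\<^sub>R d) \<longlongrightarrow> a) (at_right 0)"
      by (rule tendsto_eq_intros refl | simp)+
    have "\<forall>\<^sub>F t in at_right 0. \<phi> k (a + t *\<^sub>R d) < \<phi> i (a + t *\<^sub>R d)"
      if k: "k \<in> {1..p} - {i}" for k
    proof (cases "k \<in> active \<phi> p a")
      case True
      let ?h = "\<lambda>t. \<phi> i (a + t *\<^sub>R d) - \<phi> k (a + t *\<^sub>R d)"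
      have der: "((\<lambda>t. \<phi> j (a + t *\<^sub>R d)) has_derivative (\<lambda>t. (t *\<^sub>R d) \<bullet> gradient (\<phi> j) a)) (at 0)"
        if "j \<in> {1..p}" for j
      proof -
        have "((\<lambda>t. a + t *\<^sub>R d) has_derivative (\<lambda>t. t *\<^sub>R d)) (at 0)"
          by (auto intro!: derivative_eq_intros)
        moreover have "(\<phi> j has_derivative (\<lambda>h. h \<bullet> gradient (\<phi> j) a)) (at (a + 0 *\<^sub>R d))"
          using C2_GDERIV[OF C2[OF that], of a] by (simp add: gderiv_def)
        ultimately show ?thesis by (rule has_derivative_compose)
      qed
      have "(?h has_derivative (\<lambda>t. (t *\<^sub>R d) \<bullet> gradient (\<phi> i) a - (t *\<^sub>R d) \<bullet> gradient (\<phi> k) a)) (at 0)"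
        using der[OF ip] der[of k] k by (intro derivative_intros) auto
      moreover have "(\<lambda>t. (t *\<^sub>R d) \<bullet> gradient (\<phi> i) a - (t *\<^sub>R d) \<bullet> gradient (\<phi> k) a) = (*) 1"
        using d[of k] k True
        by (auto simp: fun_eq_iff inner_diff_left inner_diff_right inner_commute
            simp flip: right_diff_distrib)
      ultimately have "DERIV ?h 0 :> 1" by (simp add: has_field_derivative_def)
      then obtain e where e: "e > 0" "\<And>t. t > 0 \<Longrightarrow> t < e \<Longrightarrow> ?h 0 < ?h t"
        using DERIV_pos_inc_right[of ?h 1 0] by auto
      have "?h 0 = 0" using i True unfolding active_def by simp
      with e show ?thesis unfolding eventually_at_right_field by (intro exI[of _ e]) auto
    next
      case False
      then have less: "\<phi> k a < \<phi> i a"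
        using k i max_fun_ge[of k p \<phi> a] unfolding active_def by fastforce
      have "((\<lambda>t. \<phi> j (a + t *\<^sub>R d)) \<longlongrightarrow> \<phi> j a) (at_right 0)" if "j \<in> {1..p}" for j
        using isCont_tendsto_compose[OF C2_isCont[OF C2[OF that]] path] .
      from tendsto_diff[OF this[OF ip] this[of k]] k less show ?thesis
        using order_tendstoD(1)[of "\<lambda>t. \<phi> i (a + t *\<^sub>R d) - \<phi> k (a + t *\<^sub>R d)" _ "at_right 0" 0]
        by simp
    qed
    then have "\<forall>\<^sub>F t in at_right 0. \<forall>k\<in>{1..p} - {i}. \<phi> k (a + t *\<^sub>R d) < \<phi> i (a + t *\<^sub>R d)"
      by (intro eventually_ball_finite) auto
    moreover have "\<forall>\<^sub>F t in at_right 0. a + t *\<^sub>R d \<in> ball a r"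
      using topological_tendstoD[OF path open_ball[of a r]] r by simp
    ultimately have "\<forall>\<^sub>F t in at_right 0. a + t *\<^sub>R d \<in> A"
      unfolding A_def by eventually_elim auto
    then have "\<exists>t. a + t *\<^sub>R d \<in> A"
      using eventually_happens'[of "at_right (0::real)"] by fastforce
    then show ?thesis by blast
  qed
  moreover have "max_fun \<phi> p u = \<phi> i u" if "u \<in> A" for u
    using that ip unfolding A_def by (intro max_fun_eqI) (auto intro: less_imp_le)
  moreover have "A \<subseteq> ball a r" unfolding A_def by blast
  ultimately show ?thesis by blast
qed

section \<open>Duality and predicted reduction\<close>

lemma inner_matrix_vector_transpose:
  fixes A :: "real^'n^'m"
  shows "(A *v x) \<bullet> y = x \<bullet> (transpose A *v y)"
  by (metis dot_lmul_matrix inner_commute transpose_matrix_vector)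

lemma sym_pos_def_inverse:
  assumes "sym_pos_def H"
  shows "H *v (matrix_inv H *v g) = g"
proof -
  have "inj ((*v) H)"
  proof (rule injI)
    fix x y assume "H *v x = H *v y"
    then have "(x - y) \<bullet> (H *v (x - y)) = 0"
      by (simp add: matrix_vector_mult_diff_distrib)
    with assms show "x = y" unfolding sym_pos_def_def by (metis eq_iff_diff_eq_0 less_irrefl)
  qed
  then have "invertible H"
    by (metis invertible_left_inverse matrix_left_invertible_injective)
  then have "H ** matrix_inv H = mat 1"
    unfolding invertible_def matrix_inv_def by (metis (mono_tags, lifting) someI_ex)
  then show ?thesis by (metis matrix_vector_mul_assoc matrix_vector_mul_lid)
qed

lemma sym_pos_def_inverse_symmetric:
  assumes "sym_pos_def H"
  shows "u \<bullet> (matrix_inv H *v g) = g \<bullet> (matrix_inv H *v u)"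
proof -
  let ?K = "matrix_inv H"
  have "u \<bullet> (?K *v g) = (H *v (?K *v u)) \<bullet> (?K *v g)"
    by (simp add: sym_pos_def_inverse[OF assms])
  also have "\<dots> = (?K *v u) \<bullet> (transpose H *v (?K *v g))"
    by (rule inner_matrix_vector_transpose)
  also have "\<dots> = (?K *v u) \<bullet> (H *v (?K *v g))"
    using assms unfolding sym_pos_def_def by simp
  also have "\<dots> = g \<bullet> (?K *v u)"
    by (simp add: sym_pos_def_inverse[OF assms] inner_commute)
  finally show ?thesis .
qed

lemma sym_pos_def_inverse_quadratic:
  assumes "sym_pos_def H"
  shows "(g + t *\<^sub>R u) \<bullet> (matrix_inv H *v (g + t *\<^sub>R u)) =
    g \<bullet> (matrix_inv H *v g) + 2 * t * (u \<bullet> (matrix_inv H *v g)) + t\<^sup>2 * (u \<bullet> (matrix_inv H *v u))"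
  using sym_pos_def_inverse_symmetric[OF assms, of u g]
  by (simp add: matrix_vector_right_distrib matrix_vector_mult_scaleR inner_left_distrib
      inner_right_distrib power2_eq_square algebra_simps)

text \<open>
  The first-order condition at a maximum: it is applied to directional perturbations of the dual
  maximiser, along which the dual objective is linear up to a quadratic term.
\<close>

lemma first_order_nonpos:
  fixes a b :: real
  assumes "\<And>t. 0 < t \<Longrightarrow> t \<le> 1 \<Longrightarrow> a * t \<le> b * t\<^sup>2"
  shows "a \<le> 0"
proof (rule ccontr)
  assume a: "\<not> a \<le> 0"
  define t where "t = min 1 (a / (2 * (\<bar>b\<bar> + 1)))"
  have t: "0 < t" "t \<le> 1" using a unfolding t_def by (auto intro!: divide_pos_pos)
  have "a \<le> b * t" using assms[OF t] t by (simp add: power2_eq_square mult.assoc[symmetric])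
  also have "\<dots> \<le> \<bar>b\<bar> * t" using t by (intro mult_right_mono) auto
  also have "\<dots> \<le> \<bar>b\<bar> * (a / (2 * (\<bar>b\<bar> + 1)))"
    unfolding t_def by (intro mult_left_mono) auto
  also have "\<dots> < a"
  proof -
    have "0 \<le> a * \<bar>b\<bar>" using a by (intro mult_nonneg_nonneg) auto
    then have "0 < a * \<bar>b\<bar> + a * 2" using a by linarith
    then show ?thesis by (simp add: field_simps)
  qed
  finally show False by simp
qed

text \<open>
  This is the half of strong duality that bounds the primal value from above, made
  explicit: with \<open>g = G l + w\<close> the primal point is \<open>d = - H\<^sup>-\<^sup>1 g\<close> and
  \<open>z = l \<bullet> (ft + G\<^sup>T d)\<close>. Perturbing \<open>l\<close> towards a vertex of the simplex gives the linear constraints,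
  perturbing \<open>w\<close> along a coordinate axis gives the bound on \<open>d\<close>, and shrinking \<open>w\<close> gives
  complementarity, \<open>\<Delta> \<parallel>w\<parallel>\<^sub>1 \<le> d \<bullet> w\<close>, by which the primal value does not exceed the dual one.
\<close>

lemma dual_maximiser_yields_primal_point:
  fixes ft :: "real^'m::finite" and G :: "real^'m^'n::finite"
  assumes H: "sym_pos_def H" and \<Delta>: "\<Delta> \<ge> 0"
    and opt: "is_arg_max (dual_objective ft G H (ereal \<Delta>)) (dual_feasible (ereal \<Delta>)) (l, w)"
  obtains d z where "QP_feasible ft G (ereal \<Delta>) (d, z)"
    and "QP_objective H (d, z) \<le> dual_objective ft G H (ereal \<Delta>) (l, w)"
proof -
  let ?K = "matrix_inv H"
  let ?n1 = "\<lambda>w :: real^'n. \<Sum>i\<in>UNIV. \<bar>w $ i\<bar>"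
  define g where "g = G *v l + w"
  define d where "d = - (?K *v g)"
  define c where "c = ft + transpose G *v d"
  define z where "z = l \<bullet> c"
  have l: "(\<Sum>j\<in>UNIV. l $ j) = 1" "\<And>j. l $ j \<ge> 0"
    using opt unfolding is_arg_max_def dual_feasible_def by auto
  have max: "dual_objective ft G H (ereal \<Delta>) (l', w') \<le> dual_objective ft G H (ereal \<Delta>) (l, w)"
    if "(\<Sum>j\<in>UNIV. l' $ j) = 1" "\<And>j. l' $ j \<ge> 0" for l' w'
    using opt that unfolding is_arg_max_def dual_feasible_def by (auto simp: not_less)
  \<comment> \<open>Second-order expansion of the dual objective; \<open>c\<close> and \<open>d\<close> are the partial gradients of its
    smooth part.\<close>
  have obj: "dual_objective ft G H (ereal \<Delta>) (l + t *\<^sub>R h, w + t *\<^sub>R v)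
      = dual_objective ft G H (ereal \<Delta>) (l, w) + t * (h \<bullet> c + v \<bullet> d)
        - t\<^sup>2 * ((G *v h + v) \<bullet> (?K *v (G *v h + v)) / 2) - \<Delta> * (?n1 (w + t *\<^sub>R v) - ?n1 w)" for t h v
  proof -
    have "G *v (l + t *\<^sub>R h) + (w + t *\<^sub>R v) = g + t *\<^sub>R (G *v h + v)"
      unfolding g_def by (simp add: matrix_vector_right_distrib matrix_vector_mult_scaleR algebra_simps)
    moreover have "v \<bullet> (?K *v g) = - (v \<bullet> d)" unfolding d_def by simp
    moreover have "(G *v h) \<bullet> (?K *v g) = - (h \<bullet> (transpose G *v d))"
      unfolding d_def inner_matrix_vector_transpose[symmetric] by simp
    ultimately show ?thesis
      unfolding dual_objective_def c_def
      by (simp add: sym_pos_def_inverse_quadratic[OF H] inner_left_distrib[of "G *v h" v "?K *v g"]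
          inner_left_distrib[of l] inner_right_distrib[of h] flip: g_def)
        (simp add: field_simps)
  qed
  have constraint: "c $ j \<le> z" for j
  proof -
    define h where "h = axis j 1 - l"
    have "h \<bullet> c \<le> 0"
    proof (rule first_order_nonpos)
      fix t :: real assume t: "0 < t" "t \<le> 1"
      have nth: "(l + t *\<^sub>R h) $ i = (1 - t) * l $ i + t * (if i = j then 1 else 0)" for i
        unfolding h_def by (simp add: axis_def algebra_simps)
      have "(\<Sum>i\<in>UNIV. (l + t *\<^sub>R h) $ i) = (1 - t) * (\<Sum>i\<in>UNIV. l $ i) + t"
        unfolding nth sum.distrib sum_distrib_left[symmetric] by simp
      then have "(\<Sum>i\<in>UNIV. (l + t *\<^sub>R h) $ i) = 1" using l(1) by simp
      moreover have "(l + t *\<^sub>R h) $ i \<ge> 0" for i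
        unfolding nth using t l(2)[of i] by (intro add_nonneg_nonneg mult_nonneg_nonneg) auto
      ultimately have "dual_objective ft G H (ereal \<Delta>) (l + t *\<^sub>R h, w + t *\<^sub>R 0)
          \<le> dual_objective ft G H (ereal \<Delta>) (l, w)"
        using max[of "l + t *\<^sub>R h" "w + t *\<^sub>R 0"] by simp
      then show "(h \<bullet> c) * t \<le> ((G *v h + 0) \<bullet> (?K *v (G *v h + 0)) / 2) * t\<^sup>2"
        unfolding obj by (simp add: mult.commute)
    qed
    then show ?thesis unfolding h_def z_def by (simp add: inner_diff_left inner_axis')
  qed
  have w_step: "t * (v \<bullet> d) - \<Delta> * (?n1 (w + t *\<^sub>R v) - ?n1 w) \<le> (v \<bullet> (?K *v v) / 2) * t\<^sup>2" for t v
    using max[of l "w + t *\<^sub>R v"] l obj[of t 0 v] by (simp add: mult.commute)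
  have "infnorm d \<le> \<Delta>"
  proof -
    have dir: "(s *\<^sub>R axis i 1) \<bullet> d \<le> \<Delta>" if s: "\<bar>s\<bar> = 1" for i s
    proof -
      have n1: "?n1 (w + t *\<^sub>R (s *\<^sub>R axis i 1)) - ?n1 w \<le> t" if "t > 0" for t
      proof -
        have "?n1 (w + t *\<^sub>R (s *\<^sub>R axis i 1)) - ?n1 w \<le> (\<Sum>k\<in>UNIV. if k = i then t else 0)"
          unfolding sum_subtractf[symmetric] using that s
          by (intro sum_mono) (auto simp: axis_def abs_if split: if_splits)
        then show ?thesis by simp
      qed
      have "(s *\<^sub>R axis i 1) \<bullet> d - \<Delta> \<le> 0"
      proof (rule first_order_nonpos)
        fix t :: real assume t: "0 < t" "t \<le> 1"
        show "((s *\<^sub>R axis i 1) \<bullet> d - \<Delta>) * t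
          \<le> ((s *\<^sub>R axis i 1) \<bullet> (?K *v (s *\<^sub>R axis i 1)) / 2) * t\<^sup>2"
          using w_step[of t "s *\<^sub>R axis i 1"] mult_left_mono[OF n1[OF t(1)] \<Delta>]
          by (simp add: algebra_simps)
      qed
      then show ?thesis by simp
    qed
    have "\<bar>d $ i\<bar> \<le> \<Delta>" for i
      using dir[of 1 i] dir[of "-1" i] by (simp add: inner_axis' abs_le_iff)
    then show ?thesis by (simp add: infnorm_cart) (intro cSup_least; auto)
  qed
  moreover have "\<Delta> * ?n1 w \<le> d \<bullet> w"
  proof -
    have "\<Delta> * ?n1 w - d \<bullet> w \<le> 0"
    proof (rule first_order_nonpos)
      fix t :: real assume t: "0 < t" "t \<le> 1"
      have "?n1 (w + t *\<^sub>R - w) = (1 - t) * ?n1 w"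
      proof -
        have "\<bar>(w + t *\<^sub>R - w) $ i\<bar> = (1 - t) * \<bar>w $ i\<bar>" for i
          using t abs_mult[of "1 - t" "w $ i"] by (simp add: algebra_simps)
        then show ?thesis by (simp add: sum_distrib_left)
      qed
      then have "\<Delta> * (?n1 (w + t *\<^sub>R - w) - ?n1 w) = - (t * \<Delta> * ?n1 w)"
        by (simp only:) (simp add: algebra_simps)
      with w_step[of t "- w"] show "(\<Delta> * ?n1 w - d \<bullet> w) * t \<le> (- w \<bullet> (?K *v - w) / 2) * t\<^sup>2"
        by (simp only:) (simp add: algebra_simps inner_commute)
    qed
    then show ?thesis by simp
  qed
  moreover have "QP_objective H (d, z) = dual_objective ft G H (ereal \<Delta>) (l, w) + \<Delta> * ?n1 w - d \<bullet> w"
  proof -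
    have "H *v d = - g"
      using matrix_vector_mult_scaleR[of H "-1" "?K *v g"] sym_pos_def_inverse[OF H, of g]
      unfolding d_def by simp
    moreover have "l \<bullet> (transpose G *v d) = (g - w) \<bullet> d"
      unfolding g_def inner_matrix_vector_transpose[symmetric] by simp
    ultimately show ?thesis
      unfolding QP_objective_def dual_objective_def z_def c_def
      by (simp add: inner_right_distrib inner_diff_left d_def inner_commute flip: g_def)
  qed
  ultimately show ?thesis
    using that[of d z] constraint unfolding QP_feasible_def c_def by auto
qed

text \<open>
  By the previous lemma the predicted reduction is at least
  \<open>g \<bullet> H\<^sup>-\<^sup>1 g / 2 + \<Delta> \<parallel>w\<parallel>\<^sub>1\<close> with \<open>g = G l + w\<close>. The optimality measure is the norm of
  \<open>H\<^sup>-\<^sup>1 g - H\<^sup>-\<^sup>1 w\<close>, so one of these two vectors has norm at least \<open>\<nu> / 2\<close>, and ellipticity makes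
  the corresponding summand large.
\<close>

lemma Pred_lower_bound:
  fixes y :: "('n::finite, 'm::finite) grafus_pass"
  assumes step2: "step2 f s y" and \<Delta>: "s_Delta s = ereal \<Delta>" "\<Delta> \<ge> 0"
    and c: "c > 0" "\<And>d. c * (norm d)\<^sup>2 \<le> d \<bullet> (y_H y *v d)"
    and \<nu>: "0 < \<nu>" "\<nu> \<le> opt_measure f y"
  shows "min (c * \<nu>\<^sup>2 / 8) (c * \<nu> / 2 * \<Delta>) \<le> Pred f s y"
proof -
  let ?ft = "ftilde f (s_x s) (y_X y)" and ?G = "Gmat f (y_X y)" and ?H = "y_H y"
  let ?K = "matrix_inv ?H" and ?l = "y_lam y" and ?w = "y_om y"
  let ?n1 = "\<Sum>i\<in>UNIV. \<bar>?w $ i\<bar>"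
  define g where "g = ?G *v ?l + ?w"
  have H: "sym_pos_def ?H"
    and primal: "is_arg_min (QP_objective ?H) (QP_feasible ?ft ?G (ereal \<Delta>)) (y_d y, y_z y)"
    and dual: "is_arg_max (dual_objective ?ft ?G ?H (ereal \<Delta>)) (dual_feasible (ereal \<Delta>)) (?l, ?w)"
    using step2 \<Delta> unfolding step2_def Let_def by auto
  obtain d z where "QP_feasible ?ft ?G (ereal \<Delta>) (d, z)"
    and "QP_objective ?H (d, z) \<le> dual_objective ?ft ?G ?H (ereal \<Delta>) (?l, ?w)"
    using dual_maximiser_yields_primal_point[OF H \<Delta>(2) dual] .
  then have "QP_objective ?H (y_d y, y_z y) \<le> dual_objective ?ft ?G ?H (ereal \<Delta>) (?l, ?w)"
    using primal unfolding is_arg_min_def by (meson linorder_not_less order_trans)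
  moreover have "?l \<bullet> ?ft \<le> Max (range (\<lambda>j. ?ft $ j))"
  proof -
    have l: "(\<Sum>j\<in>UNIV. ?l $ j) = 1" "\<And>j. ?l $ j \<ge> 0"
      using dual unfolding is_arg_max_def dual_feasible_def by auto
    have "?l \<bullet> ?ft \<le> (\<Sum>j\<in>UNIV. ?l $ j * Max (range (\<lambda>j. ?ft $ j)))"
      unfolding inner_vec_def using l(2) by (auto intro!: sum_mono mult_left_mono Max_ge)
    then show ?thesis using l(1) by (simp flip: sum_distrib_right)
  qed
  ultimately have "Pred f s y \<ge> g \<bullet> (?K *v g) / 2 + \<Delta> * ?n1"
    unfolding Pred_def dual_objective_def g_def by simp
  moreover have curv: "c * (norm (?K *v g))\<^sup>2 \<le> g \<bullet> (?K *v g)" for g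
    using c(2)[of "?K *v g"] by (simp add: sym_pos_def_inverse[OF H] inner_commute)
  moreover have "\<Delta> * ?n1 \<ge> 0" using \<Delta>(2) by (simp add: sum_nonneg)
  moreover have "g \<bullet> (?K *v g) \<ge> 0"
    using curv[of g] c(1) by (meson less_imp_le mult_nonneg_nonneg order_trans zero_le_power2)
  moreover consider "norm (?K *v g) \<ge> \<nu> / 2" | "norm (?K *v ?w) \<ge> \<nu> / 2"
  proof -
    have "?K *v (?G *v ?l) = ?K *v g - ?K *v ?w"
      unfolding g_def by (simp add: matrix_vector_right_distrib)
    then have "\<nu> \<le> norm (?K *v g - ?K *v ?w)" using \<nu>(2) unfolding opt_measure_def by simp
    also have "\<dots> \<le> norm (?K *v g) + norm (?K *v ?w)" by (rule norm_triangle_ineq4)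
    finally show ?thesis using that by linarith
  qed
  then have "c * \<nu>\<^sup>2 / 4 \<le> g \<bullet> (?K *v g) \<or> c * \<nu> / 2 * \<Delta> \<le> \<Delta> * ?n1"
  proof cases
    case 1
    then have "(\<nu> / 2)\<^sup>2 \<le> (norm (?K *v g))\<^sup>2" using \<nu> by (intro power_mono) auto
    then have "c * (\<nu> / 2)\<^sup>2 \<le> c * (norm (?K *v g))\<^sup>2" using c(1) by simp
    with curv[of g] have "c * (\<nu> / 2)\<^sup>2 \<le> g \<bullet> (?K *v g)" by linarith
    then show ?thesis by (simp add: power_divide)
  next
    case 2
    have "c * norm (?K *v ?w) * norm (?K *v ?w) \<le> norm ?w * norm (?K *v ?w)"
      using curv[of ?w] norm_cauchy_schwarz[of ?w "?K *v ?w"] by (simp add: power2_eq_square mult.assoc)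
    then have "c * norm (?K *v ?w) \<le> norm ?w"
      by (rule mult_right_le_imp_le) (use 2 \<nu>(1) in linarith)
    moreover have "c * (\<nu> / 2) \<le> c * norm (?K *v ?w)" using 2 c(1) by simp
    ultimately have "c * \<nu> / 2 \<le> ?n1" using norm_le_l1_cart[of ?w] by linarith
    then show ?thesis using mult_right_mono[OF _ \<Delta>(2)] by (metis mult.commute)
  qed
  ultimately show ?thesis by linarith
qed

section \<open>Samples that force acceptance\<close>

lemma gradient_max_fun_on_piece:
  assumes "C2 (\<phi> i)" "open A" "u \<in> A" "\<And>v. v \<in> A \<Longrightarrow> max_fun \<phi> p v = \<phi> i v"
  shows "gradient (max_fun \<phi> p) u = gradient (\<phi> i) u"
proof (rule gradient_eqI)
  have "(\<phi> i has_derivative (\<lambda>h. h \<bullet> gradient (\<phi> i) u)) (at u)"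
    using C2_GDERIV[OF assms(1), of u] by (simp add: gderiv_def)
  then show "GDERIV (max_fun \<phi> p) u :> gradient (\<phi> i) u"
    unfolding gderiv_def
    by (rule has_derivative_transform_within_open[OF _ assms(2,3)]) (simp add: assms(4))
qed

lemma Gmat_transpose_nth: "(transpose (Gmat f X) *v d) $ j = gradient f (X j) \<bullet> d"
  by (simp add: matrix_vector_mult_def transpose_def Gmat_def inner_vec_def)

text \<open>
  The index map \<open>\<iota>\<close> assigns to each sample point a piece that agrees with \<open>f\<close> to first order at that
  point. The first conclusion says that the model does not overestimate \<open>f\<close> at \<open>x\<close>, the second that
  a model value \<open>z\<close> at \<open>x + d\<close> does not underestimate \<open>f\<close> there, both up to \<open>\<eta>\<close> times the distances
  involved.
\<close>

definition sampled_model_accurate ::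
  "(nat \<Rightarrow> real^'n \<Rightarrow> real) \<Rightarrow> (real^'n \<Rightarrow> real) \<Rightarrow> ('m::finite \<Rightarrow> nat) \<Rightarrow> real \<Rightarrow> (real^'n) set \<Rightarrow> bool"
where
  "sampled_model_accurate \<phi> f \<iota> \<eta> B \<longleftrightarrow> (\<forall>x d z \<rho> X.
     x \<in> B \<longrightarrow> x + d \<in> B \<longrightarrow>
     (\<forall>j. X j \<in> B \<and> f (X j) = \<phi> (\<iota> j) (X j) \<and> gradient f (X j) = gradient (\<phi> (\<iota> j)) (X j) \<and>
          norm (x - X j) \<le> \<rho> \<and> (ftilde f x X + transpose (Gmat f X) *v d) $ j \<le> z) \<longrightarrow>
     (\<forall>j. ftilde f x X $ j \<le> f x + \<eta> * \<rho>) \<and> f (x + d) \<le> z + \<eta> * (\<rho> + norm d))"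

text \<open>
  Near \<open>a\<close> the value of \<open>f\<close> at \<open>x + d\<close> is attained by an active piece, and since \<open>\<iota>\<close> reaches every
  active piece, one of the model's cuts is the linearization of that very piece at a nearby point.
  Strict differentiability controls the linearization error.
\<close>

lemma sampled_model_accurate_near:
  fixes \<phi> :: "nat \<Rightarrow> real^'n \<Rightarrow> real" and \<iota> :: "'m::finite \<Rightarrow> nat"
  assumes p: "p \<ge> 1" and C2: "\<And>i. i \<in> {1..p} \<Longrightarrow> C2 (\<phi> i)" and \<eta>: "\<eta> > 0"
    and \<iota>: "range \<iota> = active \<phi> p a"
  obtains R where "R > 0" "sampled_model_accurate \<phi> (max_fun \<phi> p) \<iota> \<eta> (ball a R)"
proof -
  define f where "f = max_fun \<phi> p"
  obtain R0 where R0: "R0 > 0"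
    and act: "\<And>y. y \<in> ball a R0 \<Longrightarrow> \<exists>i\<in>active \<phi> p a. f y = \<phi> i y"
    using only_active_pieces_near[where \<phi> = \<phi> and p = p and a = a, OF p C2] unfolding f_def by blast
  have "\<exists>R>0. \<forall>u\<in>ball a R. \<forall>v\<in>ball a R.
      \<bar>\<phi> i v - (\<phi> i u + gradient (\<phi> i) u \<bullet> (v - u))\<bar> \<le> \<eta> * norm (v - u)" if "i \<in> {1..p}" for i
    using C2_strict_differentiability[OF C2[OF that] \<eta>, of a] by metis
  then obtain Q where Q: "\<And>i. i \<in> {1..p} \<Longrightarrow> Q i > 0"
    and Qd: "\<And>i u v. i \<in> {1..p} \<Longrightarrow> u \<in> ball a (Q i) \<Longrightarrow> v \<in> ball a (Q i) \<Longrightarrow>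
      \<bar>\<phi> i v - (\<phi> i u + gradient (\<phi> i) u \<bullet> (v - u))\<bar> \<le> \<eta> * norm (v - u)"
    by metis
  define R where "R = Min (insert R0 (Q ` {1..p}))"
  have "R > 0" unfolding R_def using R0 Q by simp
  have RR0: "R \<le> R0" and RQ: "\<And>i. i \<in> {1..p} \<Longrightarrow> R \<le> Q i"
    unfolding R_def by (rule Min_le; simp)+
  have main: "(\<forall>j. ftilde f x X $ j \<le> f x + \<eta> * \<rho>) \<and> f (x + d) \<le> z + \<eta> * (\<rho> + norm d)"
    if x: "x \<in> ball a R" and xd: "x + d \<in> ball a R"
      and samples: "\<forall>j. X j \<in> ball a R \<and> f (X j) = \<phi> (\<iota> j) (X j)
        \<and> gradient f (X j) = gradient (\<phi> (\<iota> j)) (X j)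
        \<and> norm (x - X j) \<le> \<rho> \<and> (ftilde f x X + transpose (Gmat f X) *v d) $ j \<le> z"
    for x d z \<rho> X
  proof
    have X: "X j \<in> ball a R" and fX: "f (X j) = \<phi> (\<iota> j) (X j)"
      and gX: "gradient f (X j) = gradient (\<phi> (\<iota> j)) (X j)" and \<rho>: "norm (x - X j) \<le> \<rho>"
      and z: "(ftilde f x X + transpose (Gmat f X) *v d) $ j \<le> z" for j
      using samples by auto
    have ip: "\<iota> j \<in> {1..p}" for j using \<iota> unfolding active_def by auto
    have lin: "\<bar>\<phi> (\<iota> j) v - (\<phi> (\<iota> j) (X j) + gradient (\<phi> (\<iota> j)) (X j) \<bullet> (v - X j))\<bar>
        \<le> \<eta> * norm (v - X j)" if "v \<in> ball a R" for j v
      using that X[of j] RQ[OF ip[of j]] by (intro Qd[OF ip]) auto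
    show "\<forall>j. ftilde f x X $ j \<le> f x + \<eta> * \<rho>"
    proof
      fix j
      have "ftilde f x X $ j \<le> \<phi> (\<iota> j) x + \<eta> * norm (x - X j)"
        using lin[OF x, of j] unfolding ftilde_def by (simp add: fX gX abs_le_iff)
      moreover have "\<eta> * norm (x - X j) \<le> \<eta> * \<rho>" using \<eta> \<rho> by simp
      moreover have "\<phi> (\<iota> j) x \<le> f x" unfolding f_def by (rule max_fun_ge[OF ip])
      ultimately show "ftilde f x X $ j \<le> f x + \<eta> * \<rho>" by linarith
    qed
    obtain i where "i \<in> active \<phi> p a" and i: "f (x + d) = \<phi> i (x + d)"
      using act[of "x + d"] xd RR0 by auto
    then obtain j where j: "i = \<iota> j" using \<iota> by blast
    have "norm (x + d - X j) \<le> \<rho> + norm d"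
      using norm_triangle_ineq[of "x - X j" d] \<rho>[of j] by (simp add: algebra_simps)
    then have "\<eta> * norm (x + d - X j) \<le> \<eta> * (\<rho> + norm d)" using \<eta> by simp
    moreover have "(ftilde f x X + transpose (Gmat f X) *v d) $ j
        = \<phi> (\<iota> j) (X j) + gradient (\<phi> (\<iota> j)) (X j) \<bullet> (x + d - X j)"
      unfolding vector_add_component Gmat_transpose_nth
      by (simp add: ftilde_def fX gX inner_add_right inner_diff_right)
    ultimately show "f (x + d) \<le> z + \<eta> * (\<rho> + norm d)"
      using lin[OF xd, of j] z[of j] unfolding i j by (simp add: abs_le_iff)
  qed
  have "sampled_model_accurate \<phi> f \<iota> \<eta> (ball a R)"
    unfolding sampled_model_accurate_def by (intro allI impI, rule main; assumption)
  with \<open>R > 0\<close> show ?thesis unfolding f_def by (rule that)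
qed

lemma finite_range_cover:
  assumes "finite I" "I \<noteq> {}" "card I \<le> CARD('m::finite)"
  obtains \<iota> :: "'m::finite \<Rightarrow> 'b" where "range \<iota> = I"
proof -
  obtain g :: "'b \<Rightarrow> 'm" where g: "inj_on g I"
    using card_le_inj[OF assms(1) finite[of "UNIV :: 'm set"]] assms(3) by auto
  obtain i0 where i0: "i0 \<in> I" using assms(2) by blast
  define \<iota> where "\<iota> j = (if j \<in> g ` I then inv_into I g j else i0)" for j
  have "range \<iota> \<subseteq> I" unfolding \<iota>_def using i0 by (auto simp: inv_into_into)
  moreover have "i = \<iota> (g i)" if "i \<in> I" for i
    unfolding \<iota>_def using that g by simp
  then have "I \<subseteq> range \<iota>" by blast
  ultimately show ?thesis using that by blast
qed

text \<open>
  The sampling radius is \<open>\<epsilon>\<close> to a power in \<open>[1, 2]\<close>; this and the next lemma bound it independently of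
  the power.
\<close>

lemma powr_ge_min_square:
  fixes e \<sigma> :: real
  assumes "e > 0" "1 \<le> \<sigma>" "\<sigma> \<le> 2"
  shows "(min 1 e)\<^sup>2 \<le> e powr \<sigma>"
proof (cases "e \<ge> 1")
  case True
  then show ?thesis using assms by (simp add: ge_one_powr_ge_zero)
next
  case False
  then have "e powr 2 \<le> e powr \<sigma>" using assms by (intro powr_mono') auto
  with False assms show ?thesis by simp
qed

lemma powr_le_max_square:
  fixes e \<sigma> :: real
  assumes "e > 0" "1 \<le> \<sigma>" "\<sigma> \<le> 2"
  shows "e powr \<sigma> \<le> (max 1 e)\<^sup>2"
proof -
  have "e powr \<sigma> \<le> (max 1 e) powr \<sigma>" using assms by (intro powr_mono2) auto
  also have "\<dots> \<le> (max 1 e) powr 2" using assms by (intro powr_mono) auto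
  finally show ?thesis by simp
qed

text \<open>
  Sample sets \<open>A j\<close> for one level \<open>l\<close>: whatever the value of \<open>\<nu> \<in> [a, 1]\<close>, at level \<open>l\<close> and from an
  iterate within \<open>r\<close> of \<open>xb\<close> the ball from which samples are drawn has radius at least \<open>2 r\<close> and thus
  contains all \<open>A j\<close>, and samples taken from them force acceptance as soon as the predicted reduction
  is at least \<open>\<kappa> \<Delta>\<close>.
\<close>

definition accepting_samples ::
  "(real^'n \<Rightarrow> real) \<Rightarrow> 'n grafus_params \<Rightarrow> real \<Rightarrow> real \<Rightarrow> real^'n \<Rightarrow> nat \<Rightarrow> real \<Rightarrow>
   ('m::finite \<Rightarrow> (real^('n::finite)) set) \<Rightarrow> bool"
where
  "accepting_samples f P a \<kappa> xb l r A \<longleftrightarrow>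
     0 < r \<and> (\<forall>j. open (A j) \<and> A j \<noteq> {} \<and> A j \<subseteq> ball xb r) \<and>
     (\<forall>\<nu> \<sigma>. a \<le> \<nu> \<longrightarrow> \<nu> \<le> 1 \<longrightarrow> 1 \<le> \<sigma> \<longrightarrow> \<sigma> \<le> 2 \<longrightarrow>
        2 * r \<le> (p_gamma_eps P * \<nu> * p_theta P ^ l) powr \<sigma>) \<and>
     (\<forall>s (y :: ('n, 'm) grafus_pass) \<nu>. a \<le> \<nu> \<longrightarrow> \<nu> \<le> 1 \<longrightarrow> s_x s \<in> ball xb r \<longrightarrow> (\<forall>j. y_X y j \<in> A j) \<longrightarrow>
        s_Delta s = ereal (p_gamma_Delta P * \<nu> * p_theta P ^ l) \<longrightarrow> step2 f s y \<longrightarrow>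
        \<kappa> * (p_gamma_Delta P * \<nu> * p_theta P ^ l) \<le> Pred f s y \<longrightarrow>
        p_rho P * Pred f s y < Ared f s y)"

text \<open>
  The order of choices matters. The accuracy \<open>\<eta>\<close> is fixed first, so that the model error
  \<open>\<eta> (2 + \<surd>n) \<Delta>\<close> is half of the margin \<open>(1 - \<rho>) \<kappa> \<Delta>\<close>; it determines a ball of radius \<open>R\<close> on
  which models are that accurate. Then the level \<open>l\<close> is chosen so large that trial points stay in this
  ball, and only then the radius \<open>r\<close>, small compared with the trust radius and the sampling radius at
  level \<open>l\<close>.
\<close>

lemma accepting_samples_exist:
  fixes \<phi> :: "nat \<Rightarrow> real^'n \<Rightarrow> real" and P :: "'n grafus_params"
  assumes p: "p \<ge> 1" and C2: "\<And>i. i \<in> {1..p} \<Longrightarrow> C2 (\<phi> i)"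
    and aff: "active_gradients_affinely_independent \<phi> p"
    and m: "CARD('m::finite) \<ge> CARD('n) + 1"
    and P: "valid_params P" and \<kappa>: "\<kappa> > 0" and a: "a > 0" and f: "f = max_fun \<phi> p"
  shows "\<exists>l r (A :: 'm::finite \<Rightarrow> (real^'n) set). accepting_samples f P a \<kappa> xb l r A"
proof -
  let ?S = "sqrt (real CARD('n))" and ?\<theta> = "p_theta P"
  have pars: "0 < p_gamma_eps P" "0 < p_gamma_Delta P" "0 < ?\<theta>" "?\<theta> < 1" "0 < p_rho P" "p_rho P < 1"
    using P unfolding valid_params_def by auto
  have S0: "?S \<ge> 0" by simp
  define \<eta> where "\<eta> = (1 - p_rho P) * \<kappa> / (2 * (2 + ?S))"
  have \<eta>: "\<eta> > 0" unfolding \<eta>_def using pars \<kappa> S0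
    by (intro divide_pos_pos mult_pos_pos) (auto intro: add_pos_nonneg)
  have \<eta>_eq: "\<eta> * (2 + ?S) = (1 - p_rho P) * \<kappa> / 2" 
  proof -
    have "2 + ?S > 0" using S0 by (intro add_pos_nonneg) auto
    then have "2 * (2 + ?S) \<noteq> 0" by simp
    then have "\<eta> * (2 * (2 + ?S)) = (1 - p_rho P) * \<kappa>"
      unfolding \<eta>_def by (simp only: times_divide_eq_left nonzero_mult_div_cancel_right not_False_eq_True)
    then show ?thesis by (simp add: algebra_simps)
  qed
  let ?I = "active \<phi> p xb"
  have "finite ?I" unfolding active_def by simp
  moreover have "card ?I \<le> CARD('m)" using card_active_le[OF aff, of xb] m by linarith
  ultimately obtain \<iota> :: "'m \<Rightarrow> nat" where \<iota>: "range \<iota> = ?I"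
    using finite_range_cover[OF _ active_nonempty[OF p], where 'm = 'm] by blast
  obtain R where R: "R > 0" and acc: "sampled_model_accurate \<phi> f \<iota> \<eta> (ball xb R)"
    using sampled_model_accurate_near[OF p C2 \<eta> \<iota>] unfolding f by blast
  obtain l where "?\<theta> ^ l < R / (2 * (p_gamma_Delta P * (?S + 1)))"
    using real_arch_pow_inv[of "R / (2 * (p_gamma_Delta P * (?S + 1)))" ?\<theta>] R pars S0
    by (auto intro!: divide_pos_pos mult_pos_pos add_nonneg_pos)
  then have l: "?S * (p_gamma_Delta P * ?\<theta> ^ l) < R / 2"
  proof -
    assume "?\<theta> ^ l < R / (2 * (p_gamma_Delta P * (?S + 1)))"
    then have "?\<theta> ^ l * (p_gamma_Delta P * (?S + 1)) < R / 2"
      using pars S0 by (simp add: pos_less_divide_eq add_nonneg_pos algebra_simps)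
    moreover have "0 < ?\<theta> ^ l * p_gamma_Delta P" using pars by simp
    ultimately show ?thesis by (simp add: algebra_simps)
  qed
  \<comment> \<open>Least trust and sampling parameters at level \<open>l\<close>, attained for \<open>\<nu> = a\<close>.\<close>
  define \<Delta>0 where "\<Delta>0 = p_gamma_Delta P * a * ?\<theta> ^ l"
  define e0 where "e0 = p_gamma_eps P * a * ?\<theta> ^ l"
  define r where "r = Min {\<Delta>0 / 2, (min 1 e0)\<^sup>2 / 2, R / 2}"
  have pos: "\<Delta>0 > 0" "e0 > 0" unfolding \<Delta>0_def e0_def using pars a by simp_all
  have r: "r > 0" "2 * r \<le> \<Delta>0" "2 * r \<le> (min 1 e0)\<^sup>2" "r \<le> R / 2"
  proof -
    have "r \<le> \<Delta>0 / 2" "r \<le> (min 1 e0)\<^sup>2 / 2" "r \<le> R / 2"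
      unfolding r_def by (rule Min_le; simp)+
    then show "2 * r \<le> \<Delta>0" "2 * r \<le> (min 1 e0)\<^sup>2" "r \<le> R / 2" by simp_all
    show "r > 0" unfolding r_def using pos R by simp
  qed
  have "\<exists>A. open A \<and> A \<noteq> {} \<and> A \<subseteq> ball xb r \<and> (\<forall>u\<in>A. f u = \<phi> (\<iota> j) u)" for j
    unfolding f using \<iota> by (intro piece_dominates_somewhere_near[OF _ aff _ r(1)] C2) auto
  then obtain A where A: "\<And>j. open (A j)" "\<And>j. A j \<noteq> {}" "\<And>j. A j \<subseteq> ball xb r"
    and fA: "\<And>j u. u \<in> A j \<Longrightarrow> f u = \<phi> (\<iota> j) u"
    by metis
  have radius: "2 * r \<le> (p_gamma_eps P * \<nu> * ?\<theta> ^ l) powr \<sigma>"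
    if "a \<le> \<nu>" "\<nu> \<le> 1" "1 \<le> \<sigma>" "\<sigma> \<le> 2" for \<nu> \<sigma>
  proof -
    have e: "e0 \<le> p_gamma_eps P * \<nu> * ?\<theta> ^ l"
      unfolding e0_def using that pars by (intro mult_right_mono mult_left_mono) auto
    have "(min 1 e0)\<^sup>2 \<le> (min 1 (p_gamma_eps P * \<nu> * ?\<theta> ^ l))\<^sup>2"
      using e pos by (intro power_mono min.mono) auto
    with r(3) have "2 * r \<le> (min 1 (p_gamma_eps P * \<nu> * ?\<theta> ^ l))\<^sup>2" by linarith
    also have "\<dots> \<le> (p_gamma_eps P * \<nu> * ?\<theta> ^ l) powr \<sigma>"
      using that e pos by (intro powr_ge_min_square) auto
    finally show ?thesis .
  qed
  have accept: "p_rho P * Pred f s y < Ared f s y"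
    if \<nu>: "a \<le> \<nu>" "\<nu> \<le> 1" and x: "s_x s \<in> ball xb r" and XA: "\<And>j. y_X y j \<in> A j"
      and \<Delta>s: "s_Delta s = ereal (p_gamma_Delta P * \<nu> * ?\<theta> ^ l)" and step2: "step2 f s y"
      and Pred: "\<kappa> * (p_gamma_Delta P * \<nu> * ?\<theta> ^ l) \<le> Pred f s y"
    for s and y :: "('n, 'm) grafus_pass" and \<nu>
  proof -
    define \<Delta> where "\<Delta> = p_gamma_Delta P * \<nu> * ?\<theta> ^ l"
    let ?d = "y_d y" and ?x = "s_x s" and ?ft = "ftilde f (s_x s) (y_X y)"
    have \<Delta>: "\<Delta>0 \<le> \<Delta>" "\<Delta> \<le> p_gamma_Delta P * ?\<theta> ^ l"
      unfolding \<Delta>_def \<Delta>0_def using \<nu> pars a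
      by (auto intro!: mult_right_mono mult_left_mono simp: mult_le_cancel_left1)
    have H: "sym_pos_def (y_H y)" and feas: "QP_feasible ?ft (Gmat f (y_X y)) (ereal \<Delta>) (?d, y_z y)"
      using step2 \<Delta>s unfolding step2_def Let_def is_arg_min_def \<Delta>_def by auto
    have "norm ?d \<le> ?S * infnorm ?d" using norm_le_infnorm[of ?d] by simp
    also have "\<dots> \<le> ?S * \<Delta>"
      using feas S0 unfolding QP_feasible_def by (intro mult_left_mono) auto
    finally have d: "norm ?d \<le> ?S * \<Delta>" .
    also have "\<dots> \<le> ?S * (p_gamma_Delta P * ?\<theta> ^ l)" using \<Delta>(2) S0 by (rule mult_left_mono)
    finally have dR: "norm ?d < R / 2" using l by linarith
    have near: "norm (?x - y_X y j) \<le> \<Delta>" for j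
    proof -
      have "y_X y j \<in> ball xb r" using A(3) XA by blast
      then have "dist ?x (y_X y j) < r + r"
        using x dist_triangle[of ?x "y_X y j" xb] by (simp add: dist_commute)
      then show ?thesis using r(2) \<Delta>(1) by (simp add: dist_norm)
    qed
    have xR: "?x \<in> ball xb R" using x r(1,4) by auto
    have "dist xb (?x + ?d) \<le> dist xb ?x + norm ?d"
      using dist_triangle[of xb "?x + ?d" ?x] by (simp add: dist_norm)
    then have xdR: "?x + ?d \<in> ball xb R" using x r(4) dR by auto
    have samples: "y_X y j \<in> ball xb R \<and> f (y_X y j) = \<phi> (\<iota> j) (y_X y j)
        \<and> gradient f (y_X y j) = gradient (\<phi> (\<iota> j)) (y_X y j) \<and> norm (?x - y_X y j) \<le> \<Delta>
        \<and> (?ft + transpose (Gmat f (y_X y)) *v ?d) $ j \<le> y_z y" for j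
    proof (intro conjI)
      show "y_X y j \<in> ball xb R" using A(3)[of j] XA[of j] r(1,4) by fastforce
      show "f (y_X y j) = \<phi> (\<iota> j) (y_X y j)" using fA XA by blast
      have "\<iota> j \<in> {1..p}" using \<iota> unfolding active_def by auto
      then show "gradient f (y_X y j) = gradient (\<phi> (\<iota> j)) (y_X y j)"
        unfolding f
        by (rule gradient_max_fun_on_piece[OF C2 A(1) XA fA[unfolded f]])
      show "norm (?x - y_X y j) \<le> \<Delta>" by (rule near)
      show "(?ft + transpose (Gmat f (y_X y)) *v ?d) $ j \<le> y_z y"
        using feas unfolding QP_feasible_def by auto
    qed
    from samples have "(\<forall>j. ?ft $ j \<le> f ?x + \<eta> * \<Delta>) \<and> f (?x + ?d) \<le> y_z y + \<eta> * (\<Delta> + norm ?d)"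
      using acc[unfolded sampled_model_accurate_def, THEN spec[of _ ?x], THEN spec[of _ ?d],
          THEN spec[of _ "y_z y"], THEN spec[of _ \<Delta>], THEN spec[of _ "y_X y"]] xR xdR
      by simp
    moreover define top where "top = Max (range (\<lambda>j. ?ft $ j))"
    ultimately have ft: "top \<le> f ?x + \<eta> * \<Delta>"
      and fd: "f (?x + ?d) \<le> y_z y + \<eta> * (\<Delta> + norm ?d)" by auto
    have "\<eta> * (\<Delta> + norm ?d) \<le> \<eta> * (\<Delta> + ?S * \<Delta>)" using d \<eta> by simp
    moreover have "?d \<bullet> (y_H y *v ?d) \<ge> 0"
      using H unfolding sym_pos_def_def by (cases "?d = 0") (auto intro: less_imp_le)
    moreover have "Pred f s y = top - (y_z y + ?d \<bullet> (y_H y *v ?d) / 2)"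
      unfolding Pred_def QP_objective_def top_def by simp
    ultimately have "Ared f s y \<ge> Pred f s y - \<eta> * (2 + ?S) * \<Delta>"
      using ft fd unfolding Ared_def by (simp add: algebra_simps)
    moreover have "\<eta> * (2 + ?S) * \<Delta> < (1 - p_rho P) * Pred f s y"
    proof -
      have "\<eta> * (2 + ?S) * \<Delta> = (1 - p_rho P) * (\<kappa> * \<Delta>) / 2" unfolding \<eta>_eq by simp
      also have "\<dots> < (1 - p_rho P) * (\<kappa> * \<Delta>)" using pars \<kappa> pos \<Delta>(1) by simp
      also have "\<dots> \<le> (1 - p_rho P) * Pred f s y"
        using Pred pars unfolding \<Delta>_def by (intro mult_left_mono) auto
      finally show ?thesis .
    qed
    ultimately show ?thesis by (simp add: algebra_simps)
  qed
  have "accepting_samples f P a \<kappa> xb l r A"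
    unfolding accepting_samples_def
    by (intro conjI allI impI r(1) A radius; (rule accept; blast)?)
  then show ?thesis by blast
qed

section \<open>A conditional Borel-Cantelli lemma\<close>

text \<open>
  One step of the supermartingale used below: the factor doubles as a bet that pays \<open>1 / (1 - q)\<close> when
  the opportunity \<open>E\<close> is missed and nothing when \<open>B\<close> occurs. Since \<open>B\<close> has conditional probability at
  least \<open>q\<close> on \<open>E\<close>, the bet is not favourable.
\<close>

lemma subalgebra_prob_expectation_step:
  assumes "prob_space M" and sub: "subalgebra M G"
    and W: "W \<in> borel_measurable G" "\<And>\<omega>. 0 \<le> W \<omega>" "\<And>\<omega>. W \<omega> \<le> c"
    and E: "E \<in> sets G" and B: "B \<in> sets M"
    and q: "0 < q" "q < 1"
    and cond: "AE \<omega> in M. \<omega> \<in> E \<longrightarrow> q \<le> real_cond_exp M G (indicat_real B) \<omega>"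
  shows "(\<integral>\<omega>. W \<omega> * (if \<omega> \<in> E then if \<omega> \<in> B then 0 else 1 / (1 - q) else 1) \<partial>M) \<le> (\<integral>\<omega>. W \<omega> \<partial>M)"
proof -
  interpret prob_space M by fact
  interpret finite_measure_subalgebra M G by unfold_locales (fact sub)
  have [measurable]: "W \<in> borel_measurable M" "W \<in> borel_measurable G"
    using W(1) measurable_from_subalg[OF sub] by auto
  have [measurable]: "E \<in> sets G" "E \<in> sets M" "B \<in> sets M"
    using E B sub unfolding subalgebra_def by auto
  have bdd: "integrable M (\<lambda>\<omega>. W \<omega> * g \<omega>)" if "g \<in> borel_measurable M" "\<And>\<omega>. \<bar>g \<omega>\<bar> \<le> k" for g k
  proof (rule integrable_const_bound[where B = "c * k"])
    show "AE \<omega> in M. norm (W \<omega> * g \<omega>) \<le> c * k"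
      using W that(2) by (auto intro!: AE_I2 mult_mono simp: abs_mult intro: order_trans[OF W(2) W(3)])
  qed (use that(1) in measurable)
  have iW: "integrable M W" using bdd[of "\<lambda>_. 1" 1] by simp
  have iE: "integrable M (\<lambda>\<omega>. W \<omega> * indicat_real E \<omega>)" by (rule bdd[of _ 1]) (auto simp: indicator_def)
  have iEB: "integrable M (\<lambda>\<omega>. (W \<omega> * indicat_real E \<omega>) * indicat_real B \<omega>)"
    unfolding mult.assoc by (rule bdd[of _ 1]) (auto simp: indicator_def)
  have G: "(\<lambda>\<omega>. W \<omega> * indicat_real E \<omega>) \<in> borel_measurable G" by measurable
  note ce = real_cond_exp_intg[OF iEB G]
  have "q * (\<integral>\<omega>. W \<omega> * indicat_real E \<omega> \<partial>M)
      = (\<integral>\<omega>. q * (W \<omega> * indicat_real E \<omega>) \<partial>M)" by simp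
  also have "\<dots> \<le> (\<integral>\<omega>. (W \<omega> * indicat_real E \<omega>) * real_cond_exp M G (indicat_real B) \<omega> \<partial>M)"
  proof (rule integral_mono_AE)
    show "AE \<omega> in M. q * (W \<omega> * indicat_real E \<omega>)
        \<le> (W \<omega> * indicat_real E \<omega>) * real_cond_exp M G (indicat_real B) \<omega>"
      using cond by eventually_elim (auto simp: indicator_def mult.commute[of q] intro!: mult_left_mono W(2))
    show "integrable M (\<lambda>\<omega>. q * (W \<omega> * indicat_real E \<omega>))" using iE by simp
    show "integrable M (\<lambda>\<omega>. (W \<omega> * indicat_real E \<omega>) * real_cond_exp M G (indicat_real B) \<omega>)"
      by (rule ce(1)) simp
  qed
  also have "\<dots> = (\<integral>\<omega>. (W \<omega> * indicat_real E \<omega>) * indicat_real B \<omega> \<partial>M)"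
    by (rule ce(2)) simp
  finally have key: "q * (\<integral>\<omega>. W \<omega> * indicat_real E \<omega> \<partial>M)
      \<le> (\<integral>\<omega>. (W \<omega> * indicat_real E \<omega>) * indicat_real B \<omega> \<partial>M)" .
  have "(\<integral>\<omega>. W \<omega> * (if \<omega> \<in> E then if \<omega> \<in> B then 0 else 1 / (1 - q) else 1) \<partial>M)
     = (\<integral>\<omega>. W \<omega> + (q / (1 - q) * (W \<omega> * indicat_real E \<omega>)
          - 1 / (1 - q) * ((W \<omega> * indicat_real E \<omega>) * indicat_real B \<omega>)) \<partial>M)"
  proof (intro Bochner_Integration.integral_cong refl)
    fix \<omega>
    have "W \<omega> * (1 / (1 - q)) = W \<omega> * (1 + q * (1 / (1 - q)))"
      using q by (simp add: field_simps)
    then have "W \<omega> * (1 / (1 - q)) = W \<omega> + q / (1 - q) * W \<omega>"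
      by (simp add: distrib_left mult.commute)
    then show "W \<omega> * (if \<omega> \<in> E then if \<omega> \<in> B then 0 else 1 / (1 - q) else 1)
      = W \<omega> + (q / (1 - q) * (W \<omega> * indicat_real E \<omega>)
          - 1 / (1 - q) * ((W \<omega> * indicat_real E \<omega>) * indicat_real B \<omega>))"
      by (cases "\<omega> \<in> E"; cases "\<omega> \<in> B") (simp_all add: algebra_simps)
  qed
  also have "\<dots> = (\<integral>\<omega>. W \<omega> \<partial>M) + (q / (1 - q) * (\<integral>\<omega>. W \<omega> * indicat_real E \<omega> \<partial>M)
          - 1 / (1 - q) * (\<integral>\<omega>. (W \<omega> * indicat_real E \<omega>) * indicat_real B \<omega> \<partial>M))"
    using iW iE iEB by simp
  also have "\<dots> \<le> (\<integral>\<omega>. W \<omega> \<partial>M)"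
    using key q by (simp add: divide_right_mono)
  finally show ?thesis .
qed

text \<open>
  The product \<open>W\<close> of the betting factors from time \<open>N\<close> on has expectation at most 1, so by Fatou's lemma
  its lower limit is almost surely finite. On outcomes with infinitely many opportunities and no
  success after time \<open>N\<close> it would be infinite.
\<close>

theorem conditional_Borel_Cantelli:
  assumes M: "prob_space M" and filt: "filtration (space M) F" and sub: "\<And>t. subalgebra M (F t)"
    and E: "\<And>t. E t \<in> sets (F t)" and B: "\<And>t. B t \<in> sets (F (Suc t))"
    and q: "0 < q"
    and cond: "\<And>t. AE \<omega> in M. \<omega> \<in> E t \<longrightarrow> q \<le> real_cond_exp M (F t) (indicat_real (B t)) \<omega>"
  shows "AE \<omega> in M. (\<exists>\<^sub>\<infinity>t. \<omega> \<in> E t) \<longrightarrow> (\<exists>\<^sub>\<infinity>t. \<omega> \<in> E t \<and> \<omega> \<in> B t)"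
proof -
  interpret prob_space M by fact
  \<comment> \<open>The factor \<open>1 / (1 - r)\<close> requires a bound below 1.\<close>
  define r where "r = min q (1/2)"
  have r: "0 < r" "r < 1" using q unfolding r_def by auto
  have cond_r: "AE \<omega> in M. \<omega> \<in> E t \<longrightarrow> r \<le> real_cond_exp M (F t) (indicat_real (B t)) \<omega>" for t
    using cond[of t] by eventually_elim (auto simp: r_def)
  define h where "h t \<omega> = (if \<omega> \<in> E t then if \<omega> \<in> B t then 0 else 1 / (1 - r) else 1)" for t \<omega>
  have FM: "sets (F t) \<subseteq> sets M" for t using sub unfolding subalgebra_def by blast
  have Fmono: "sets (F s) \<subseteq> sets (F t)" if "s \<le> t" for s t
    using filtration.sets_F_mono[OF filt that] .
  have h_bounds: "0 \<le> h t \<omega>" "h t \<omega> \<le> 1 / (1 - r)" for t \<omega>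
    using r unfolding h_def by auto
  have finitely: "AE \<omega> in M. (\<forall>t\<ge>N. \<omega> \<in> E t \<longrightarrow> \<omega> \<notin> B t) \<longrightarrow> \<not> (\<exists>\<^sub>\<infinity>t. \<omega> \<in> E t)" for N
  proof -
    define W where "W t \<omega> = (\<Prod>s\<in>{N..<t}. h s \<omega>)" for t \<omega>
    have hF: "h s \<in> borel_measurable (F t)" if "s < t" for s t
    proof -
      have [measurable]: "E s \<in> sets (F t)" "B s \<in> sets (F t)"
        using E[of s] B[of s] Fmono[of s t] Fmono[of "Suc s" t] that by auto
      show ?thesis unfolding h_def by measurable
    qed
    have WF: "W t \<in> borel_measurable (F t)" for t
      unfolding W_def by (intro borel_measurable_prod hF) auto
    have WM [measurable]: "W t \<in> borel_measurable M" for t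
      by (rule measurable_from_subalg[OF sub WF])
    have W0: "0 \<le> W t \<omega>" for t \<omega> unfolding W_def by (intro prod_nonneg h_bounds(1))
    have Wc: "W t \<omega> \<le> (1 / (1 - r)) ^ card {N..<t}" for t \<omega>
      unfolding W_def using h_bounds prod_mono[of "{N..<t}" "\<lambda>s. h s \<omega>" "\<lambda>_. 1 / (1 - r)"] by simp
    have EW: "(\<integral>\<omega>. W t \<omega> \<partial>M) \<le> 1" for t
    proof (induction t)
      case 0
      then show ?case unfolding W_def by (simp add: prob_space)
    next
      case (Suc t)
      show ?case
      proof (cases "N \<le> t")
        case True
        then have "W (Suc t) = (\<lambda>\<omega>. W t \<omega> * h t \<omega>)"
          unfolding W_def by (simp add: atLeastLessThanSuc mult.commute)
        then have "(\<integral>\<omega>. W (Suc t) \<omega> \<partial>M) = (\<integral>\<omega>. W t \<omega> * h t \<omega> \<partial>M)" by simp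
        also have "\<dots> \<le> (\<integral>\<omega>. W t \<omega> \<partial>M)"
          unfolding h_def
          by (rule subalgebra_prob_expectation_step[OF M sub WF W0 Wc E _ r cond_r]) (use B FM in auto)
        finally have "(\<integral>\<omega>. W (Suc t) \<omega> \<partial>M) \<le> (\<integral>\<omega>. W t \<omega> \<partial>M)" .
        with Suc show ?thesis by simp
      next
        case False
        then show ?thesis unfolding W_def by (simp add: prob_space)
      qed
    qed
    have "(\<integral>\<^sup>+\<omega>. liminf (\<lambda>t. ennreal (W t \<omega>)) \<partial>M) \<le> liminf (\<lambda>t. \<integral>\<^sup>+\<omega>. ennreal (W t \<omega>) \<partial>M)"
      by (rule nn_integral_liminf) simp
    also have "\<dots> \<le> 1"
    proof -
      have "integrable M (W t)" for t
        using W0 Wc by (intro integrable_const_bound[where B = "(1 / (1 - r)) ^ card {N..<t}"]) auto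
      then have "(\<integral>\<^sup>+\<omega>. ennreal (W t \<omega>) \<partial>M) \<le> 1" for t
        using EW[of t] W0 by (simp add: nn_integral_eq_integral ennreal_le_1)
      then have "liminf (\<lambda>t. \<integral>\<^sup>+\<omega>. ennreal (W t \<omega>) \<partial>M) \<le> liminf (\<lambda>t. 1 :: ennreal)"
        by (intro Liminf_mono) auto
      then show ?thesis by (simp add: Liminf_const)
    qed
    finally have "(\<integral>\<^sup>+\<omega>. liminf (\<lambda>t. ennreal (W t \<omega>)) \<partial>M) \<noteq> \<infinity>"
      by (metis ennreal_one_less_top infinity_ennreal_def linorder_not_less)
    then have "AE \<omega> in M. liminf (\<lambda>t. ennreal (W t \<omega>)) \<noteq> \<infinity>"
      by (intro nn_integral_PInf_AE) auto
    then show ?thesis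
    proof eventually_elim
      case (elim \<omega>)
      show ?case
      proof (intro impI notI)
        assume fail: "\<forall>t\<ge>N. \<omega> \<in> E t \<longrightarrow> \<omega> \<notin> B t" and inf: "\<exists>\<^sub>\<infinity>t. \<omega> \<in> E t"
        define V where "V t = {s \<in> {N..<t}. \<omega> \<in> E s}" for t
        have WV: "W t \<omega> = (1 / (1 - r)) ^ card (V t)" for t
        proof -
          have "W t \<omega> = (\<Prod>s\<in>{N..<t}. if \<omega> \<in> E s then 1 / (1 - r) else 1)"
            unfolding W_def using fail by (intro prod.cong) (auto simp: h_def)
          also have "\<dots> = (\<Prod>s\<in>V t. 1 / (1 - r))"
            unfolding V_def by (simp add: prod.If_cases Int_def)
          finally show ?thesis by simp
        qed
        have "filterlim (\<lambda>t. card (V t)) at_top sequentially"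
        proof (rule filterlim_at_top[THEN iffD2], rule allI)
          fix K
          have "infinite ({t. \<omega> \<in> E t} - {..<N})"
            using inf by (intro Diff_infinite_finite) (auto simp: frequently_cofinite)
          then obtain T where T: "T \<subseteq> {t. \<omega> \<in> E t} - {..<N}" "card T = K" "finite T"
            using infinite_arbitrarily_large by metis
          obtain m where m: "T \<subseteq> {..<m}" using T(3) finite_nat_iff_bounded by blast
          have "K \<le> card (V t)" if "t \<ge> m" for t
            unfolding T(2)[symmetric] V_def using T(1) m that
            by (intro card_mono) (auto simp: subset_iff not_less)
          then show "\<forall>\<^sub>F t in sequentially. K \<le> card (V t)"
            unfolding eventually_sequentially by blast
        qed
        moreover have "filterlim (\<lambda>k. (1 / (1 - r)) ^ k) at_top sequentially"
          using r by (intro filterlim_at_infinity_imp_filterlim_at_top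
              filterlim_realpow_sequentially_gt1) auto
        ultimately have "filterlim (\<lambda>t. W t \<omega>) at_top sequentially"
          unfolding WV by (rule filterlim_compose[rotated])
        then have "(\<lambda>t. ennreal (W t \<omega>)) \<longlonglongrightarrow> \<infinity>"
          by (simp add: ennreal_tendsto_top_eq_at_top)
        then have "liminf (\<lambda>t. ennreal (W t \<omega>)) = \<infinity>"
          by (intro lim_imp_Liminf) auto
        with elim show False by simp
      qed
    qed
  qed
  then have "AE \<omega> in M. \<forall>N. (\<forall>t\<ge>N. \<omega> \<in> E t \<longrightarrow> \<omega> \<notin> B t) \<longrightarrow> \<not> (\<exists>\<^sub>\<infinity>t. \<omega> \<in> E t)"
    unfolding AE_all_countable by blast
  then show ?thesis
  proof eventually_elim
    case (elim \<omega>)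
    show ?case
    proof (intro impI, rule ccontr)
      assume inf: "\<exists>\<^sub>\<infinity>t. \<omega> \<in> E t" and "\<not> (\<exists>\<^sub>\<infinity>t. \<omega> \<in> E t \<and> \<omega> \<in> B t)"
      then obtain N where "\<forall>t\<ge>N. \<omega> \<in> E t \<longrightarrow> \<omega> \<notin> B t"
        by (auto simp: not_frequently MOST_nat_le)
      with elim inf show False by blast
    qed
  qed
qed

section \<open>Runs in which the optimality parameter stagnates\<close>

definition rejects ::
  "(real^'n \<Rightarrow> real) \<Rightarrow> 'n grafus_params \<Rightarrow> ('n::finite) grafus_state \<Rightarrow>
   ('n, 'm::finite) grafus_pass \<Rightarrow> bool" where
  "rejects f P s y \<longleftrightarrow> s_phase s = Sampling \<and> s_nu s \<le> opt_measure f y \<and>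
     Ared f s y \<le> p_rho P * Pred f s y"

definition accepts ::
  "(real^'n \<Rightarrow> real) \<Rightarrow> 'n grafus_params \<Rightarrow> ('n::finite) grafus_state \<Rightarrow>
   ('n, 'm::finite) grafus_pass \<Rightarrow> bool" where
  "accepts f P s y \<longleftrightarrow> s_phase s = Sampling \<and> s_nu s \<le> opt_measure f y \<and>
     p_rho P * Pred f s y < Ared f s y"

text \<open>
  The invariant of a run that never halts: in a sampling pass \<open>\<epsilon>\<close> and \<open>\<Delta>\<close> are functions of \<open>\<nu>\<close> and
  the level.
\<close>

definition consistent_state :: "'n grafus_params \<Rightarrow> ('n::finite) grafus_state \<Rightarrow> bool" where
  "consistent_state P s \<longleftrightarrow> 0 < s_nu s \<and> s_nu s < 1 \<and> 1 \<le> s_sigma s \<and> s_sigma s \<le> 2 \<and>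
     (s_phase s = Sampling \<and> s_eps s = p_gamma_eps P * s_nu s * p_theta P ^ s_l s \<and>
        s_Delta s = ereal (p_gamma_Delta P * s_nu s * p_theta P ^ s_l s) \<or>
      s_phase s = Resolving \<and> s_Delta s = \<infinity>)"

text \<open>
  If \<open>k\<close> were constant from \<open>t0\<close> on, then only finitely many values of \<open>k\<close> would occur.
\<close>

lemma infinite_iterates_index_not_constant:
  assumes "infinite_iterates S" and const: "\<And>t. t \<ge> t0 \<Longrightarrow> s_k (S t) = s_k (S t0)"
  shows False
proof -
  have in_initial: "s_k (S t) \<in> (\<lambda>t. s_k (S t)) ` {..t0}" for t
    by (metis atMost_iff const imageI nat_le_linear order_refl)
  have "UNIV \<subseteq> (\<lambda>t. s_k (S t)) ` {..t0}"
  proof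
    fix k
    obtain t where "s_k (S t) = k" using assms(1) unfolding infinite_iterates_def by blast
    with in_initial[of t] show "k \<in> (\<lambda>t. s_k (S t)) ` {..t0}" by simp
  qed
  then show ?thesis by (meson finite_atMost finite_imageI finite_subset infinite_UNIV_nat)
qed

text \<open>
  A halted state repeats forever, which freezes \<open>k\<close>.
\<close>

lemma run_never_halts:
  assumes run: "grafus_run f D P S Y" and inf: "infinite_iterates S"
  shows "s_phase (S t) \<noteq> Halted"
proof
  assume halt: "s_phase (S t) = Halted"
  have "S u = S t" if "u \<ge> t" for u
    using that
  proof (induction u rule: dec_induct)
    case (step u)
    have "transition f D P (S u) (Y u) (S (Suc u))" using run unfolding grafus_run_def by blast
    with step halt have "S (Suc u) = (S t)\<lparr>s_phase := Halted\<rparr>"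
      unfolding transition_def reaches_step2_def by simp
    also have "\<dots> = S t" using halt by (cases "S t") simp
    finally show ?case .
  qed simp
  then show False using infinite_iterates_index_not_constant[OF inf, of t] by metis
qed

lemma run_step:
  assumes run: "grafus_run f D P S Y" and inf: "infinite_iterates S"
  shows "reaches_step2 D (S t) (Y t)" "step2 f (S t) (Y t)" "steps_3_to_6 f P (S t) (Y t) (S (Suc t))"
proof -
  have "transition f D P (S t) (Y t) (S (Suc t))" using run unfolding grafus_run_def by blast
  moreover have "s_phase (S (Suc t)) \<noteq> Halted" by (rule run_never_halts[OF run inf])
  ultimately show "reaches_step2 D (S t) (Y t)" "step2 f (S t) (Y t)"
      "steps_3_to_6 f P (S t) (Y t) (S (Suc t))"
    unfolding transition_def by (auto split: if_splits)
qed

text \<open>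
  The four ways in which a pass can end: the two outcomes of the reduction test, a decrease of \<open>\<nu>\<close>, and
  the passage to an infinite trust radius. The last one is possible only from a sampling pass, because
  every step is shorter than an infinite radius.
\<close>

lemma pass_outcomes:
  fixes P :: "('n::finite) grafus_params"
  assumes P: "valid_params P" "p_nu_opt P = 0"
    and s: "consistent_state P s" and step: "steps_3_to_6 f P s y s'"
  obtains
    (reject) "rejects f P s y" "s_phase s' = Sampling" "s_k s' = s_k s" "s_l s' = Suc (s_l s)"
      "s_x s' = s_x s" "s_nu s' = s_nu s" "consistent_state P s'"
  | (accept) "accepts f P s y" "s_phase s' = Sampling" "s_k s' = Suc (s_k s)" "s_l s' = 0"
      "s_x s' = s_x s + y_d y" "s_nu s' = s_nu s" "consistent_state P s'"
  | (reduce) "s_nu s' \<le> p_delta P * s_nu s" "consistent_state P s'"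
  | (resolve) "s_phase s = Sampling" "s_phase s' = Resolving" "s_nu s' = s_nu s" "consistent_state P s'"
proof -
  have pars: "0 < p_delta P" "p_delta P < 1" "0 < p_theta P" using P unfolding valid_params_def by auto
  have \<nu>: "0 < s_nu s" "s_nu s < 1" using s unfolding consistent_state_def by auto
  show thesis
  proof (cases "s_nu s \<le> opt_measure f y \<and> s_Delta s < \<infinity>")
    case True
    then have ph: "s_phase s = Sampling" using s unfolding consistent_state_def by auto
    show thesis
    proof (cases "Ared f s y \<le> p_rho P * Pred f s y")
      case rej: True
      with True step have s': "s' = s\<lparr>s_phase := Sampling, s_l := Suc (s_l s),
          s_eps := p_theta P * s_eps s, s_Delta := ereal (p_theta P) * s_Delta s\<rparr>"
        unfolding steps_3_to_6_def by simp
      show thesis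
        using True rej ph s
        by (intro reject) (auto simp: s' rejects_def consistent_state_def)
    next
      case acc: False
      with True step have "s' = step6 P s y (s_nu s) (s_sigma s)"
        unfolding steps_3_to_6_def by simp
      then have s': "s' = \<lparr>s_phase = Sampling, s_k = Suc (s_k s), s_l = 0, s_x = s_x s + y_d y,
             s_sigma = s_sigma s, s_nu = s_nu s, s_eps = p_gamma_eps P * s_nu s,
             s_Delta = ereal (p_gamma_Delta P * s_nu s)\<rparr>"
        unfolding step6_def using P(2) \<nu> by simp
      show thesis
        using True acc ph s
        by (intro accept) (auto simp: s' accepts_def consistent_state_def)
    qed
  next
    case nostep: False
    show thesis
    proof (cases "ereal (infnorm (y_d y)) < s_Delta s")
      case True
      define \<nu>' where "\<nu>' = min (max (opt_measure f y) (s_nu s powr p_varrho P)) (p_delta P * s_nu s)"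
      obtain \<sigma>' where \<sigma>': "\<sigma>' \<in> {1..2}" and "s' = step6 P s y \<nu>' \<sigma>'"
        using step True nostep unfolding steps_3_to_6_def \<nu>'_def by (auto split: if_splits)
      moreover have \<nu>': "0 < \<nu>'" "\<nu>' \<le> p_delta P * s_nu s"
        unfolding \<nu>'_def using \<nu> pars by (auto simp: less_max_iff_disj)
      ultimately have s': "s' = \<lparr>s_phase = Sampling, s_k = Suc (s_k s), s_l = 0, s_x = s_x s + y_d y,
             s_sigma = \<sigma>', s_nu = \<nu>', s_eps = p_gamma_eps P * \<nu>',
             s_Delta = ereal (p_gamma_Delta P * \<nu>')\<rparr>"
        unfolding step6_def using P(2) by simp
      have "p_delta P * s_nu s < 1 * 1" using pars \<nu> by (intro mult_strict_mono) auto
      then show thesis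
        using \<sigma>' \<nu>' by (intro reduce) (auto simp: s' consistent_state_def)
    next
      case False
      then have s': "s' = s\<lparr>s_phase := Resolving, s_l := Suc (s_l s), s_Delta := \<infinity>\<rparr>"
        using step nostep unfolding steps_3_to_6_def by (auto split: if_splits)
      show thesis
        using s False by (intro resolve) (auto simp: s' consistent_state_def)
    qed
  qed
qed

lemma run_consistent:
  assumes P: "valid_params P" "p_nu_opt P = 0"
    and run: "grafus_run f D P S Y" and inf: "infinite_iterates S"
  shows "consistent_state P (S t)"
proof (induction t)
  case 0
  have "S 0 = initial_state P" using run unfolding grafus_run_def by blast
  with P(1) show ?case
    unfolding valid_params_def initial_state_def consistent_state_def by simp
next
  case (Suc t)
  show ?case using P Suc run_step(3)[OF run inf, of t] by (rule pass_outcomes)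
qed

text \<open>
  The counter \<open>k\<close> grows by at most one in each pass, so the first pass belonging to \<open>k\<close> has number at
  least \<open>k\<close>: the sequence \<open>\<nu>\<^sub>k\<close> is read off along passes whose numbers tend to infinity.
\<close>

lemma nu_seq_tendsto_0:
  assumes run: "grafus_run f D P S Y" and inf: "infinite_iterates S"
    and lim: "(\<lambda>t. s_nu (S t)) \<longlonglongrightarrow> 0"
  shows "nu_seq S \<longlonglongrightarrow> 0"
proof -
  have le: "s_k (S t) \<le> t" for t
  proof (induction t)
    case 0
    then show ?case using run unfolding grafus_run_def by (simp add: initial_state_def)
  next
    case (Suc t)
    have "s_k (S (Suc t)) \<le> Suc (s_k (S t))"
      using run_step(3)[OF run inf, of t] unfolding steps_3_to_6_def step6_def
      by (auto split: if_splits)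
    with Suc show ?case by simp
  qed
  have "k \<le> (LEAST t. s_k (S t) = k)" for k
    using inf le unfolding infinite_iterates_def by (metis (mono_tags, lifting) LeastI_ex)
  then have "filterlim (\<lambda>k. LEAST t. s_k (S t) = k) at_top sequentially"
    by (intro filterlim_at_top_mono[OF filterlim_ident]) auto
  from filterlim_compose[OF lim this] show ?thesis
    unfolding nu_seq_def[abs_def] .
qed

text \<open>
  The deterministic half of the contradiction. Once \<open>\<nu> < L / \<delta>\<close>, where \<open>L > 0\<close> is the limit of \<open>\<nu>\<close>, no
  further decrease is possible; nor is a pass with infinite radius, which would be followed by a
  decrease. From then on \<open>f\<close> does not increase along the run, each acceptance at level \<open>l\<close> costs at
  least \<open>\<rho> \<beta> l\<close>, and \<open>f\<close> is bounded below, so level \<open>l\<close> accepts only finitely often.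
\<close>

lemma stagnating_run_rejects_near_limit_point:
  fixes S :: "nat \<Rightarrow> ('n::finite) grafus_state" and Y :: "nat \<Rightarrow> ('n, 'm::finite) grafus_pass"
  assumes P: "valid_params P" "p_nu_opt P = 0"
    and run: "grafus_run f D P S Y" and inf: "infinite_iterates S"
    and f: "continuous_on UNIV f" "bounded_level_sets f"
    and c: "c > 0" "\<And>t d. c * (norm d)\<^sup>2 \<le> d \<bullet> (y_H (Y t) *v d)"
    and stag: "\<not> (\<lambda>t. s_nu (S t)) \<longlonglongrightarrow> 0"
  obtains L xb where "L > 0" "\<And>t. L \<le> s_nu (S t)"
    and "\<And>l. \<forall>\<^sub>F t in sequentially. s_l (S t) = l \<longrightarrow> rejects f P (S t) (Y t)"
    and "\<And>l U. open U \<Longrightarrow> xb \<in> U \<Longrightarrow> \<exists>\<^sub>\<infinity>t. s_l (S t) = l \<and> s_x (S t) \<in> U"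
proof -
  note cons = run_consistent[OF P run inf]
  note outcome = pass_outcomes[OF P cons run_step(3)[OF run inf]]
  have pars: "0 < p_delta P" "p_delta P < 1" "0 < p_theta P" "0 < p_rho P" "0 < p_gamma_Delta P"
    using P unfolding valid_params_def by auto
  have \<nu>0: "0 < s_nu (S t)" for t using cons[of t] unfolding consistent_state_def by blast
  have dec\<nu>: "decseq (\<lambda>t. s_nu (S t))"
  proof (rule decseq_SucI)
    fix t
    have "p_delta P * s_nu (S t) \<le> 1 * s_nu (S t)"
      using pars \<nu>0[of t] by (intro mult_right_mono) auto
    then show "s_nu (S (Suc t)) \<le> s_nu (S t)" by (cases rule: outcome[of t]) auto
  qed
  obtain L where L: "(\<lambda>t. s_nu (S t)) \<longlonglongrightarrow> L" "\<And>t. L \<le> s_nu (S t)"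
    using decseq_convergent[OF dec\<nu>, of 0] \<nu>0 by (metis less_imp_le)
  have L0: "L > 0"
    using LIMSEQ_le_const[OF L(1), of 0] \<nu>0 stag L(1) by (metis less_imp_le order_le_less)
  have "L < L / p_delta P" using pars L0 by (simp add: field_simps)
  then obtain T where T: "\<And>t. t \<ge> T \<Longrightarrow> s_nu (S t) < L / p_delta P"
    using order_tendstoD(2)[OF L(1)] unfolding eventually_sequentially by blast
  have no_reduce: "\<not> s_nu (S (Suc t)) \<le> p_delta P * s_nu (S t)" if "t \<ge> T" for t
    using T[OF that] L(2)[of "Suc t"] pars by (simp add: pos_less_divide_eq mult.commute)
  have sampling: "s_phase (S t) = Sampling" if "t \<ge> T" for t
  proof (rule outcome[of t])
    assume "rejects f P (S t) (Y t)" then show ?thesis unfolding rejects_def by blast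
  next
    assume "accepts f P (S t) (Y t)" then show ?thesis unfolding accepts_def by blast
  qed (use no_reduce[OF that] in auto)
  have pass: "rejects f P (S t) (Y t) \<and> s_k (S (Suc t)) = s_k (S t) \<and> s_l (S (Suc t)) = Suc (s_l (S t))
        \<and> s_x (S (Suc t)) = s_x (S t)
      \<or> accepts f P (S t) (Y t) \<and> s_l (S (Suc t)) = 0 \<and> s_x (S (Suc t)) = s_x (S t) + y_d (Y t)"
    if "t \<ge> T" for t
    using no_reduce[OF that] sampling[of "Suc t"] that by (cases rule: outcome[of t]) auto
  \<comment> \<open>The lower bound for the predicted reduction at level \<open>l\<close>, with \<open>\<nu>\<close> replaced by its limit.\<close>
  define \<beta> where "\<beta> l = min (c * L\<^sup>2 / 8) (c * L / 2 * (p_gamma_Delta P * L * p_theta P ^ l))" for l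
  have \<beta>0: "\<beta> l > 0" for l unfolding \<beta>_def using c(1) L0 pars by simp
  define v where "v t = f (s_x (S t))" for t
  have accept_drop: "v (Suc t) < v t - p_rho P * \<beta> (s_l (S t))" if t: "t \<ge> T" and acc: "accepts f P (S t) (Y t)" for t
  proof -
    let ?\<Delta> = "p_gamma_Delta P * s_nu (S t) * p_theta P ^ s_l (S t)"
    have x: "s_x (S (Suc t)) = s_x (S t) + y_d (Y t)"
      using pass[OF t] acc unfolding rejects_def accepts_def by auto
    have \<Delta>: "s_Delta (S t) = ereal ?\<Delta>"
      using cons[of t] sampling[OF t] unfolding consistent_state_def by auto
    have le: "p_gamma_Delta P * L * p_theta P ^ s_l (S t) \<le> ?\<Delta>"
      using L(2)[of t] pars by (intro mult_right_mono mult_left_mono) auto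
    have "?\<Delta> \<ge> 0" using pars \<nu>0[of t] by simp
    moreover have "L \<le> opt_measure f (Y t)" using acc L(2)[of t] unfolding accepts_def by simp
    ultimately have "min (c * L\<^sup>2 / 8) (c * L / 2 * ?\<Delta>) \<le> Pred f (S t) (Y t)"
      using Pred_lower_bound[OF run_step(2)[OF run inf] \<Delta> _ c L0] by blast
    moreover have "\<beta> (s_l (S t)) \<le> min (c * L\<^sup>2 / 8) (c * L / 2 * ?\<Delta>)"
      unfolding \<beta>_def using le c(1) L0 by (intro min.mono mult_left_mono) auto
    ultimately have "\<beta> (s_l (S t)) \<le> Pred f (S t) (Y t)" by linarith
    then have "p_rho P * \<beta> (s_l (S t)) \<le> p_rho P * Pred f (S t) (Y t)"
      using pars by simp
    also have "\<dots> < v t - v (Suc t)" using acc unfolding accepts_def v_def x Ared_def by simp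
    finally show ?thesis by simp
  qed
  have v_Suc: "v (Suc t) \<le> v t" if "t \<ge> T" for t
    using pass[OF that]
  proof
    assume "accepts f P (S t) (Y t) \<and> s_l (S (Suc t)) = 0 \<and> s_x (S (Suc t)) = s_x (S t) + y_d (Y t)"
    moreover have "0 < p_rho P * \<beta> (s_l (S t))" using pars \<beta>0 by simp
    ultimately show ?thesis using accept_drop[OF that] by fastforce
  qed (simp add: v_def)
  define K where "K = {x. f x \<le> v T}"
  have "closed K" unfolding K_def by (intro closed_Collect_le f continuous_on_const)
  moreover have "bounded K" using f(2) unfolding bounded_level_sets_def K_def by blast
  ultimately have K: "compact K" by (simp add: compact_eq_bounded_closed)
  have vT: "v t \<le> v T" if "t \<ge> T" for t
    using that by (induction t rule: dec_induct) (use v_Suc in \<open>auto intro: order_trans\<close>)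
  then have xK: "s_x (S t) \<in> K" if "t \<ge> T" for t using that unfolding K_def v_def by blast
  obtain w where "w \<in> K" and w: "\<And>x. x \<in> K \<Longrightarrow> f w \<le> f x"
    using continuous_attains_inf[OF K _ continuous_on_subset[OF f(1)]] xK by blast
  have "decseq (\<lambda>n. v (n + T))" by (rule decseq_SucI) (simp add: v_Suc)
  moreover have "f w \<le> v (n + T)" for n unfolding v_def by (intro w xK) simp
  ultimately obtain vl where "(\<lambda>n. v (n + T)) \<longlonglongrightarrow> vl" by (metis decseq_convergent)
  then have vlim: "v \<longlonglongrightarrow> vl" by (rule LIMSEQ_offset)
  have vdiff: "(\<lambda>t. v t - v (Suc t)) \<longlonglongrightarrow> 0"
    using tendsto_diff[OF vlim LIMSEQ_Suc[OF vlim]] by simp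
  have rej: "\<forall>\<^sub>F t in sequentially. s_l (S t) = l \<longrightarrow> rejects f P (S t) (Y t)" for l
  proof -
    have "\<forall>\<^sub>F t in sequentially. v t - v (Suc t) < p_rho P * \<beta> l"
      using order_tendstoD(2)[OF vdiff] pars \<beta>0 by simp
    then show ?thesis
      using eventually_ge_at_top[of T]
    proof eventually_elim
      case (elim t)
      have "\<not> accepts f P (S t) (Y t)" if "s_l (S t) = l"
        using accept_drop[OF elim(2)] elim(1) that by fastforce
      with pass[OF elim(2)] show ?case by blast
    qed
  qed
  \<comment> \<open>Without a return to level 0 no step would be accepted any more and \<open>k\<close> would stay constant.\<close>
  have zero: "\<exists>t>t0. s_l (S t) = 0" if "t0 \<ge> T" for t0
  proof (rule ccontr)
    assume none: "\<not> ?thesis"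
    have "s_k (S t) = s_k (S t0)" if "t \<ge> t0" for t
      using that
    proof (induction t rule: dec_induct)
      case (step t)
      have "s_l (S (Suc t)) \<noteq> 0" using none step by auto
      then have "s_k (S (Suc t)) = s_k (S t)" using pass[of t] step \<open>t0 \<ge> T\<close> by auto
      with step show ?case by simp
    qed simp
    then show False using infinite_iterates_index_not_constant[OF inf, of t0] by metis
  qed
  define Z where "Z = {t. t \<ge> T \<and> s_l (S t) = 0}"
  have "infinite Z"
    unfolding infinite_nat_iff_unbounded Z_def
  proof
    fix m
    show "\<exists>n>m. n \<in> {t. t \<ge> T \<and> s_l (S t) = 0}" using zero[of "max m T"] by auto
  qed
  then have Z: "strict_mono (enumerate Z)" "\<And>n. enumerate Z n \<in> Z"
    by (rule strict_mono_enumerate, rule enumerate_in_set)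
  have ZK: "\<forall>n. s_x (S (enumerate Z n)) \<in> K" using Z(2) xK unfolding Z_def by blast
  obtain xb \<tau> where \<tau>: "strict_mono \<tau>" and lim: "((\<lambda>n. s_x (S (enumerate Z n))) \<circ> \<tau>) \<longlonglongrightarrow> xb"
    using K[unfolded compact_def, THEN spec, THEN mp, OF ZK] by blast
  from lim have conv: "(\<lambda>n. s_x (S (enumerate Z (\<tau> n)))) \<longlonglongrightarrow> xb"
    by (simp only: comp_def)
  have near: "\<exists>\<^sub>\<infinity>t. s_l (S t) = l \<and> s_x (S t) \<in> U" if U: "open U" "xb \<in> U" for l U
  proof -
    have "\<forall>\<^sub>F t in sequentially. \<forall>i\<in>{..<l}. s_l (S t) = i \<longrightarrow> rejects f P (S t) (Y t)"
      using rej by (intro eventually_ball_finite) auto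
    then obtain T' where T': "\<And>t i. t \<ge> T' \<Longrightarrow> i < l \<Longrightarrow> s_l (S t) = i \<Longrightarrow> rejects f P (S t) (Y t)"
      unfolding eventually_sequentially by auto
    obtain N where N: "\<And>n. n \<ge> N \<Longrightarrow> s_x (S (enumerate Z (\<tau> n))) \<in> U"
      using topological_tendstoD[OF conv U] unfolding eventually_sequentially by blast
    have "\<exists>t>M. s_l (S t) = l \<and> s_x (S t) \<in> U" for M
    proof -
      define n where "n = Max {N, T', Suc M}"
      define t0 where "t0 = enumerate Z (\<tau> n)"
      have "n \<le> t0"
        unfolding t0_def using strict_mono_imp_increasing[OF Z(1)] strict_mono_imp_increasing[OF \<tau>]
        by (meson order_trans)
      then have t0: "t0 \<ge> T'" "t0 > M" "t0 \<ge> T" "s_l (S t0) = 0" "s_x (S t0) \<in> U"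
        using N[of n] Z(2)[of "\<tau> n"] unfolding n_def t0_def Z_def by auto
      \<comment> \<open>Levels below \<open>l\<close> reject at this stage, so the run climbs from level 0 to level \<open>l\<close> without
        moving.\<close>
      have "i \<le> l \<Longrightarrow> s_l (S (t0 + i)) = i \<and> s_x (S (t0 + i)) = s_x (S t0)" for i
      proof (induction i)
        case (Suc i)
        then have "rejects f P (S (t0 + i)) (Y (t0 + i))" using T'[of "t0 + i" i] t0 by simp
        with Suc pass[of "t0 + i"] t0 show ?case unfolding rejects_def accepts_def by auto
      qed (simp add: t0)
      from this[of l] t0 show ?thesis by (intro exI[of _ "t0 + l"]) auto
    qed
    then show ?thesis by (simp add: INFM_nat)
  qed
  show ?thesis by (rule that[OF L0 L(2) rej near])
qed

section \<open>Infinitely many good samples\<close>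

text \<open>
  The bound is uniform over all balls of radius at most \<open>R'\<close> that contain \<open>A\<close>.
\<close>

lemma uniform_cball_measure_ge:
  fixes A :: "(real^'n) set"
  assumes A: "open A" "A \<subseteq> cball x R" and R: "0 < R" "R \<le> R'"
  shows "measure lborel A / measure lborel (cball (0::real^'n) R')
    \<le> measure (uniform_measure lborel (cball x R)) A"
proof -
  have pos: "measure lborel (cball x R) > 0" using R(1) by (rule content_cball_pos)
  have "emeasure lborel (cball x R) \<noteq> 0"
    using pos unfolding measure_def by auto
  moreover have "emeasure lborel (cball x R) \<noteq> \<infinity>"
    using emeasure_lborel_cball_finite[of x R] by auto
  ultimately have "measure (uniform_measure lborel (cball x R)) A
      = measure lborel (cball x R \<inter> A) / measure lborel (cball x R)"
    using A(1) by (intro measure_uniform_measure) auto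
  also have "cball x R \<inter> A = A" using A(2) by blast
  also have "measure lborel A / measure lborel (cball (0::real^'n) R')
      \<le> measure lborel A / measure lborel (cball x R)"
    using R pos by (intro divide_left_mono mult_pos_pos content_cball_pos)
      (auto simp: content_cball intro!: mult_left_mono power_mono)
  finally show ?thesis by simp
qed

lemma measure_lborel_open_pos:
  fixes A :: "'a::euclidean_space set"
  assumes "open A" "A \<noteq> {}" "bounded A"
  shows "measure lborel A > 0"
proof -
  obtain x where "x \<in> A" using assms(2) by blast
  then obtain e where e: "e > 0" "ball x e \<subseteq> A"
    using assms(1) open_contains_ball by blast
  have "0 < measure lborel (ball x e)" using e(1) by (rule content_ball_pos)
  also have "\<dots> \<le> measure lborel A"
    using assms(1) e emeasure_bounded_finite[OF assms(3)]
    by (intro measure_mono_fmeasurable) (auto simp: fmeasurable_def)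
  finally show ?thesis .
qed

text \<open>
  The event of an opportunity, expressed by quantities that are known before sampling. The factor 2
  ensures that the sampling ball around an iterate in \<open>ball z r\<close> contains that whole ball.
\<close>

definition samples_near ::
  "real^'n \<Rightarrow> nat \<Rightarrow> real \<Rightarrow> real \<Rightarrow> ('n::finite) grafus_state \<Rightarrow> bool" where
  "samples_near z l r R s \<longleftrightarrow> s_phase s = Sampling \<and> s_l s = l \<and> s_x s \<in> ball z r \<and>
     2 * r \<le> s_eps s powr s_sigma s \<and> s_eps s powr s_sigma s \<le> R"

text \<open>
  On \<open>samples_near\<close> the conditional probability of \<open>\<forall>j. y_X (Y t \<omega>) j \<in> A j\<close> is a product of relative
  volumes of fixed open sets in balls of bounded radius, hence bounded below by a constant.
\<close>

lemma good_samples_infinitely_often: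
  fixes A :: "'m::finite \<Rightarrow> (real^'n) set"
    and S :: "nat \<Rightarrow> 'a \<Rightarrow> ('n::finite) grafus_state" and Y :: "nat \<Rightarrow> 'a \<Rightarrow> ('n, 'm) grafus_pass"
  assumes M: "prob_space M" and rs: "random_sampling M F S Y"
    and A: "\<And>j. open (A j)" "\<And>j. A j \<noteq> {}" "\<And>j. A j \<subseteq> ball z r" and r: "0 < r"
  shows "AE \<omega> in M. (\<exists>\<^sub>\<infinity>t. samples_near z l r R (S t \<omega>)) \<longrightarrow>
    (\<exists>\<^sub>\<infinity>t. samples_near z l r R (S t \<omega>) \<and> (\<forall>j. y_X (Y t \<omega>) j \<in> A j))"
proof -
  have filt: "filtration (space M) F" and sub: "\<And>t. subalgebra M (F t)"
    and [measurable]: "\<And>t. (\<lambda>\<omega>. s_phase (S t \<omega>)) \<in> measurable (F t) (count_space UNIV)"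
      "\<And>t. (\<lambda>\<omega>. s_l (S t \<omega>)) \<in> measurable (F t) (count_space UNIV)"
      "\<And>t. (\<lambda>\<omega>. s_x (S t \<omega>)) \<in> borel_measurable (F t)"
      "\<And>t. (\<lambda>\<omega>. s_sigma (S t \<omega>)) \<in> borel_measurable (F t)"
      "\<And>t. (\<lambda>\<omega>. s_eps (S t \<omega>)) \<in> borel_measurable (F t)"
      "\<And>t j. (\<lambda>\<omega>. y_X (Y t \<omega>) j) \<in> borel_measurable (F (Suc t))"
    using rs unfolding random_sampling_def by auto
  have law: "AE \<omega> in M. s_phase (S t \<omega>) = Sampling \<longrightarrow>
      real_cond_exp M (F t) (indicat_real {\<omega>' \<in> space M. \<forall>j. y_X (Y t \<omega>') j \<in> A j}) \<omega>
      = (\<Prod>j\<in>UNIV. measure (uniform_measure lborel (sampling_ball (S t \<omega>))) (A j))" for t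
  proof -
    have "\<forall>j. A j \<in> sets borel" using A(1) by simp
    then show ?thesis
      using rs[unfolded random_sampling_def, THEN conjunct2, THEN conjunct2, THEN conjunct2,
          THEN conjunct2, THEN spec[of _ t], THEN spec[of _ A]] by (rule mp[rotated])
  qed
  have sp: "space (F t) = space M" for t using sub unfolding subalgebra_def by simp
  \<comment> \<open>The maximum only ensures a positive radius if \<open>R\<close> is too small for an opportunity to occur.\<close>
  define q where "q = (\<Prod>j\<in>UNIV. measure lborel (A j) / measure lborel (cball (0::real^'n) (max R (2 * r))))"
  have mpos: "measure lborel (A j) > 0" for j
    using A bounded_subset[OF bounded_ball A(3)] by (intro measure_lborel_open_pos) auto
  have "q > 0"
    unfolding q_def using r by (intro prod_pos divide_pos_pos mpos content_cball_pos) auto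
  define E where "E t = {\<omega> \<in> space M. samples_near z l r R (S t \<omega>)}" for t
  define B where "B t = {\<omega> \<in> space M. \<forall>j. y_X (Y t \<omega>) j \<in> A j}" for t
  have E: "E t \<in> sets (F t)" for t
  proof -
    have [measurable]: "(\<lambda>\<omega>. s_eps (S t \<omega>) powr s_sigma (S t \<omega>)) \<in> borel_measurable (F t)"
      by measurable
    show ?thesis unfolding E_def samples_near_def mem_ball sp[symmetric, of t] by measurable
  qed
  have B: "B t \<in> sets (F (Suc t))" for t
  proof -
    have [measurable]: "A j \<in> sets borel" for j using A(1) by simp
    show ?thesis unfolding B_def sp[symmetric, of "Suc t"] by measurable
  qed
  have cond: "AE \<omega> in M. \<omega> \<in> E t \<longrightarrow> q \<le> real_cond_exp M (F t) (indicat_real (B t)) \<omega>" for t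
    using law[of t]
  proof eventually_elim
    case (elim \<omega>)
    show ?case
    proof
      assume "\<omega> \<in> E t"
      then have near: "samples_near z l r R (S t \<omega>)" unfolding E_def by simp
      let ?x = "s_x (S t \<omega>)" and ?R = "s_eps (S t \<omega>) powr s_sigma (S t \<omega>)"
      have "A j \<subseteq> cball ?x ?R" for j
      proof
        fix u assume "u \<in> A j"
        then have "u \<in> ball z r" using A(3) by blast
        then have "dist ?x u < r + r"
          using near dist_triangle[of ?x u z] unfolding samples_near_def by (simp add: dist_commute)
        then show "u \<in> cball ?x ?R" using near unfolding samples_near_def by simp
      qed
      then have "q \<le> (\<Prod>j\<in>UNIV. measure (uniform_measure lborel (cball ?x ?R)) (A j))"
        unfolding q_def using near r A(1) mpos
        by (intro prod_mono conjI uniform_cball_measure_ge) (auto simp: samples_near_def)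
      also have "\<dots> = real_cond_exp M (F t) (indicat_real (B t)) \<omega>"
        using elim near unfolding samples_near_def B_def sampling_ball_def by simp
      finally show "q \<le> real_cond_exp M (F t) (indicat_real (B t)) \<omega>" .
    qed
  qed
  have "AE \<omega> in M. (\<exists>\<^sub>\<infinity>t. \<omega> \<in> E t) \<longrightarrow> (\<exists>\<^sub>\<infinity>t. \<omega> \<in> E t \<and> \<omega> \<in> B t)"
    by (rule conditional_Borel_Cantelli[OF M filt sub E B \<open>q > 0\<close> cond])
  then show ?thesis
    using AE_space by eventually_elim (simp add: E_def B_def)
qed

text \<open>
  Lindelof's theorem for a choice of one ball around each point.
\<close>

lemma countable_ball_cover:
  fixes r :: "'a::{metric_space,second_countable_topology} \<Rightarrow> real"
  assumes "\<And>x. 0 < r x"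
  obtains C where "countable C" "\<And>x. \<exists>z\<in>C. x \<in> ball z (r z)"
proof -
  obtain \<F> where \<F>: "\<F> \<subseteq> range (\<lambda>z. ball z (r z))" "countable \<F>" "\<Union>\<F> = \<Union>(range (\<lambda>z. ball z (r z)))"
    by (rule Lindelof[of "range (\<lambda>z. ball z (r z))"]) auto
  obtain C where C: "countable C" "\<F> = (\<lambda>z. ball z (r z)) ` C"
    using \<F>(1,2) countable_subset_image[of \<F> "\<lambda>z. ball z (r z)" UNIV] by blast
  have "x \<in> \<Union>\<F>" for x
    unfolding \<F>(3) using assms[of x] by (intro UN_I[of x]) auto
  then have "\<exists>z\<in>C. x \<in> ball z (r z)" for x unfolding C(2) by blast
  with C(1) show ?thesis by (rule that)
qed

section \<open>Convergence of the optimality parameter\<close>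

theorem theorem4p7:
  fixes \<phi> :: "nat \<Rightarrow> real^'n \<Rightarrow> real" and p :: nat
    and f :: "real^'n \<Rightarrow> real"
    and D :: "(real^'n) set"
    and P :: "'n grafus_params"
    and M :: "'a measure" and F :: "nat \<Rightarrow> 'a measure"
    and S :: "nat \<Rightarrow> 'a \<Rightarrow> 'n grafus_state"
    and Y :: "nat \<Rightarrow> 'a \<Rightarrow> ('n, 'm::finite) grafus_pass"
  assumes "p \<ge> 1"
    and "\<And>i. i \<in> {1..p} \<Longrightarrow> C2 (\<phi> i)"
    and "f = max_fun \<phi> p"
    and "smooth_domain f D"
    and "bounded_level_sets f"
    and "active_gradients_affinely_independent \<phi> p"
    and "CARD('m) \<ge> CARD('n) + 1"
    and "valid_params P"
    and "p_nu_opt P = 0"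
    and "prob_space M"
    and "random_sampling M F S Y"
    and "AE \<omega> in M. grafus_run f D P (\<lambda>t. S t \<omega>) (\<lambda>t. Y t \<omega>)"
    and "AE \<omega> in M. uniformly_elliptic D (\<lambda>t. S t \<omega>) (\<lambda>t. Y t \<omega>)"
  shows "AE \<omega> in M. infinite_iterates (\<lambda>t. S t \<omega>) \<longrightarrow> nu_seq (\<lambda>t. S t \<omega>) \<longlonglongrightarrow> 0"
proof -
  note P = \<open>valid_params P\<close>
  have pars: "0 < p_gamma_eps P" "0 < p_gamma_Delta P" "0 < p_theta P" "p_theta P < 1"
    using P unfolding valid_params_def by auto
  \<comment> \<open>\<open>a N\<close> is a lower bound both for \<open>\<nu>\<close> and for the ellipticity constant, and \<open>\<kappa> N\<close> makes
    \<open>\<kappa> N * \<Delta>\<close> a lower bound for the predicted reduction, because \<open>\<Delta>\<close> is at most \<open>\<gamma>\<^sub>\<Delta>\<close>.\<close>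
  define a :: "nat \<Rightarrow> real" where "a N = inverse (real (Suc N))" for N
  have a: "a N > 0" for N unfolding a_def by simp
  define \<kappa> where "\<kappa> N = min (a N * (a N)\<^sup>2 / 8 / p_gamma_Delta P) (a N * a N / 2)" for N
  have "\<kappa> N > 0" for N unfolding \<kappa>_def using a[of N] pars by simp
  then have "\<exists>l r (A :: 'm \<Rightarrow> (real^'n) set). accepting_samples f P (a N) (\<kappa> N) z l r A" for N z
    using accepting_samples_exist[OF assms(1,2,6,7) P _ a assms(3)] by blast
  then obtain l r and A :: "nat \<Rightarrow> real^'n \<Rightarrow> 'm \<Rightarrow> (real^'n) set"
    where acc: "\<And>N z. accepting_samples f P (a N) (\<kappa> N) z (l N z) (r N z) (A N z)"
    by metis
  have r: "r N z > 0" and A: "open (A N z j)" "A N z j \<noteq> {}" "A N z j \<subseteq> ball z (r N z)" for N z j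
    using acc[of N z] unfolding accepting_samples_def by auto
  have "\<exists>C. countable C \<and> (\<forall>x. \<exists>z\<in>C. x \<in> ball z (r N z))" for N
    using countable_ball_cover[of "r N"] r by metis
  then obtain C where C: "\<And>N. countable (C N)" "\<And>N x. \<exists>z\<in>C N. x \<in> ball z (r N z)" by metis
  \<comment> \<open>An upper bound for all sampling radii, since \<open>\<nu> \<le> 1\<close> and \<open>\<theta> < 1\<close>.\<close>
  define R where "R = (max 1 (p_gamma_eps P))\<^sup>2"
  have "AE \<omega> in M. \<forall>N. \<forall>z\<in>C N. (\<exists>\<^sub>\<infinity>t. samples_near z (l N z) (r N z) R (S t \<omega>)) \<longrightarrow>
      (\<exists>\<^sub>\<infinity>t. samples_near z (l N z) (r N z) R (S t \<omega>) \<and> (\<forall>j. y_X (Y t \<omega>) j \<in> A N z j))"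
    unfolding AE_all_countable AE_ball_countable[OF C(1)]
    by (intro allI ballI good_samples_infinitely_often[OF assms(10,11)] A r)
  with assms(12,13) show ?thesis
  proof eventually_elim
    case (elim \<omega>)
    let ?S = "\<lambda>t. S t \<omega>" and ?Y = "\<lambda>t. Y t \<omega>"
    note run = elim(1)
    show ?case
    proof (intro impI, rule ccontr)
      assume inf: "infinite_iterates ?S" and "\<not> nu_seq ?S \<longlonglongrightarrow> 0"
      then have stag: "\<not> (\<lambda>t. s_nu (?S t)) \<longlonglongrightarrow> 0"
        using nu_seq_tendsto_0[OF run inf] by blast
      obtain c where c: "c > 0" "\<And>t d. c * (norm d)\<^sup>2 \<le> d \<bullet> (y_H (?Y t) *v d)"
        using elim(2) run_step(1)[OF run inf] unfolding uniformly_elliptic_def by blast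
      have cont: "continuous_on UNIV f" using continuous_max_fun assms(1,2,3) by blast
      show False
      proof (rule stagnating_run_rejects_near_limit_point[OF P assms(9) run inf cont assms(5) c stag])
        fix L xb
        assume L: "L > 0" "\<And>t. L \<le> s_nu (?S t)"
          and rej: "\<And>l. \<forall>\<^sub>F t in sequentially. s_l (?S t) = l \<longrightarrow> rejects f P (?S t) (?Y t)"
          and visits: "\<And>l U. open U \<Longrightarrow> xb \<in> U \<Longrightarrow> \<exists>\<^sub>\<infinity>t. s_l (?S t) = l \<and> s_x (?S t) \<in> U"
        obtain N where N: "a N < min L c"
          using reals_Archimedean[of "min L c"] L(1) c(1) unfolding a_def by auto
        obtain z where z: "z \<in> C N" "xb \<in> ball z (r N z)" using C(2) by blast
        let ?near = "samples_near z (l N z) (r N z) R"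
        have state: "?near (?S t)"
          if lvl: "s_l (?S t) = l N z" "s_x (?S t) \<in> ball z (r N z)" and "rejects f P (?S t) (?Y t)" for t
        proof -
          have ph: "s_phase (?S t) = Sampling" using that unfolding rejects_def by blast
          then have \<nu>: "a N \<le> s_nu (?S t)" "0 < s_nu (?S t)" "s_nu (?S t) \<le> 1"
            and \<sigma>: "1 \<le> s_sigma (?S t)" "s_sigma (?S t) \<le> 2"
            and eps: "s_eps (?S t) = p_gamma_eps P * s_nu (?S t) * p_theta P ^ l N z"
            using run_consistent[OF P assms(9) run inf, of t] lvl N L(2)[of t]
            unfolding consistent_state_def by auto
          have "p_theta P ^ l N z \<le> 1" using pars by (simp add: power_le_one)
          then have "p_gamma_eps P * s_nu (?S t) * p_theta P ^ l N z \<le> p_gamma_eps P * 1 * 1"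
            using pars \<nu> by (intro mult_mono) auto
          then have "(max 1 (s_eps (?S t)))\<^sup>2 \<le> R"
            unfolding R_def eps by (intro power_mono max.mono) auto
          moreover have "s_eps (?S t) > 0" unfolding eps using pars \<nu> by simp
          then have "s_eps (?S t) powr s_sigma (?S t) \<le> (max 1 (s_eps (?S t)))\<^sup>2"
            using \<sigma> by (rule powr_le_max_square)
          moreover have "2 * r N z \<le> s_eps (?S t) powr s_sigma (?S t)"
            using acc[of N z] \<nu> \<sigma> unfolding accepting_samples_def eps by blast
          ultimately show ?thesis unfolding samples_near_def using ph lvl by simp
        qed
        have "\<exists>\<^sub>\<infinity>t. ?near (?S t)"
          using frequently_eventually_conj[OF visits[OF open_ball z(2), of "l N z"]
              rej[of "l N z", folded cofinite_eq_sequentially]]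
          by (rule frequently_elim1) (use state in blast)
        with elim(3) z(1) have "\<exists>\<^sub>\<infinity>t. ?near (?S t) \<and> (\<forall>j. y_X (?Y t) j \<in> A N z j)" by blast
        from frequently_eventually_conj[OF this rej[of "l N z", folded cofinite_eq_sequentially]]
        obtain t where "?near (?S t)" and X: "\<And>j. y_X (?Y t) j \<in> A N z j"
          and "s_l (?S t) = l N z \<longrightarrow> rejects f P (?S t) (?Y t)"
          using frequently_ex by blast
        then have x: "s_x (?S t) \<in> ball z (r N z)" and lvl: "s_l (?S t) = l N z"
          and rejt: "rejects f P (?S t) (?Y t)"
          unfolding samples_near_def by auto
        define \<Delta> where "\<Delta> = p_gamma_Delta P * s_nu (?S t) * p_theta P ^ l N z"
        have \<nu>: "a N \<le> s_nu (?S t)" "0 < s_nu (?S t)" "s_nu (?S t) \<le> 1"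
          and \<Delta>: "s_Delta (?S t) = ereal \<Delta>"
          using run_consistent[OF P assms(9) run inf, of t] lvl N L(2)[of t] rejt
          unfolding consistent_state_def rejects_def \<Delta>_def by auto
        have "p_theta P ^ l N z \<le> 1" using pars by (simp add: power_le_one)
        then have "\<Delta> \<le> p_gamma_Delta P * 1 * 1"
          unfolding \<Delta>_def using pars \<nu> by (intro mult_mono) auto
        then have \<Delta>b: "0 \<le> \<Delta>" "\<Delta> \<le> p_gamma_Delta P" unfolding \<Delta>_def using pars \<nu> by simp_all
        have step2: "step2 f (?S t) (?Y t)" by (rule run_step(2)[OF run inf])
        have "\<kappa> N * \<Delta> \<le> Pred f (?S t) (?Y t)"
        proof -
          have "a N * (norm d)\<^sup>2 \<le> d \<bullet> (y_H (?Y t) *v d)" for d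
            using c(2)[of d t] mult_right_mono[of "a N" c "(norm d)\<^sup>2"] N by simp
          moreover have "a N \<le> opt_measure f (?Y t)" using rejt \<nu>(1) unfolding rejects_def by simp
          ultimately have "min (a N * (a N)\<^sup>2 / 8) (a N * a N / 2 * \<Delta>) \<le> Pred f (?S t) (?Y t)"
            using Pred_lower_bound[OF step2 \<Delta> \<Delta>b(1) a _ a] by blast
          moreover have "\<kappa> N * \<Delta> \<le> a N * a N / 2 * \<Delta>"
            unfolding \<kappa>_def using \<Delta>b(1) by (intro mult_right_mono) auto
          moreover have "\<kappa> N * \<Delta> \<le> a N * (a N)\<^sup>2 / 8"
          proof -
            have "\<kappa> N * \<Delta> \<le> (a N * (a N)\<^sup>2 / 8 / p_gamma_Delta P) * p_gamma_Delta P"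
              unfolding \<kappa>_def using \<Delta>b a[of N] pars by (intro mult_mono) auto
            then show ?thesis using pars by simp
          qed
          ultimately show ?thesis by linarith
        qed
        then have "p_rho P * Pred f (?S t) (?Y t) < Ared f (?S t) (?Y t)"
          using acc[of N z] \<nu>(1,3) x X \<Delta> step2 unfolding accepting_samples_def \<Delta>_def by blast
        with rejt show False unfolding rejects_def by simp
      qed
    qed
  qed
qed

end
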